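(* Let $r<s$ be positive integers, $n=2r+2s$, $d=\gcd(r,s)$, and let $T_{2,2}$ be the tree with passport $[r^2,s^2;4,1^{n-4};n]$ in which the degrees of the black vertices in cyclic order around the degree-$4$ white vertex are $(r,r,s,s)$. The monodromy group $G$ of $T_{2,2}$ is, up to isomorphism, $$G=\begin{cases} S_5 & \text{if } r=1 \text{ and } s=2,\\ S_n & \text{if } d=1\text{ and } s\neq 2,\\ S_{n/d}^d\rtimes\mathbb{Z}_d & \text{if } d\neq 1\text{ and } s\neq 2r,\\ S_{(n/d)-1}^d\rtimes \mathbb{Z}_d & \text{if } d\neq 1\text{ and } s=2r,\end{cases}$$ where $\rtimes$ denotes some semidirect product.
   Context: A tree is a bicolored (black/white) plane tree, up to color- and orientation-preserving isomorphism. The passport $[\alpha;\beta;n]$ of a tree with $n$ edges records the partition $\alpha\vdash n$ of black vertex degrees and $\beta\vdash n$ of white vertex degrees ($k^m$ means $k$ repeated $m$ times). Label the edges by $1,\dots,n$; let $\sigma_0\in S_n$ (resp. $\sigma_1$) be the permutation whose cycles are the cyclic orders of edges around the black (resp. white) vertices. The monodromy group is $\langle\sigma_0,\sigma_1\rangle\le S_n$ (well defined up to conjugacy). $S_m$ is the symmetric group and $\mathbb{Z}_m$ the cyclic group of order $m$. *)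

theory Defs
  imports
    "HOL-Algebra.Algebra"
    "HOL-Combinatorics.Combinatorics"
    "HOL-Library.Multiset"
begin

section \<open>Bicolored plane trees\<close>

text \<open>
  An embedding of a connected graph with at least one edge into the oriented plane is recorded, up
  to orientation-preserving isomorphism, by the cyclic order of the edges around each vertex;
  every choice of cyclic orders on a tree is realised in the plane.  An edge is the pair of its
  black and its white end, and \<open>rot T v\<close> sends an edge at the vertex \<open>v\<close> to the next one in the
  positive direction around \<open>v\<close>; its values elsewhere are irrelevant.
\<close>

record 'v plane_graph =
  black :: "'v set"
  white :: "'v set"
  edges :: "('v \<times> 'v) set"
  rot :: "'v \<Rightarrow> 'v \<times> 'v \<Rightarrow> 'v \<times> 'v"

definition incident :: "'v plane_graph \<Rightarrow> 'v \<Rightarrow> ('v \<times> 'v) set" where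
  "incident T v = {e \<in> edges T. fst e = v \<or> snd e = v}"

definition vertex_degree :: "'v plane_graph \<Rightarrow> 'v \<Rightarrow> nat" where
  "vertex_degree T v = card (incident T v)"

definition adjacent :: "'v plane_graph \<Rightarrow> 'v \<Rightarrow> 'v \<Rightarrow> bool" where
  "adjacent T u v \<longleftrightarrow> (u, v) \<in> edges T \<or> (v, u) \<in> edges T"

definition connected_graph :: "'v plane_graph \<Rightarrow> bool" where
  "connected_graph T \<longleftrightarrow>
    (\<forall>u \<in> black T \<union> white T. \<forall>v \<in> black T \<union> white T. (adjacent T)\<^sup>*\<^sup>* u v)"

definition is_cycle :: "'v plane_graph \<Rightarrow> 'v list \<Rightarrow> bool" where
  "is_cycle T p \<longleftrightarrow>
    length p \<ge> 3 \<and> distinct p \<and> successively (adjacent T) p \<and> adjacent T (last p) (hd p)"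

text \<open>The one-vertex tree is excluded: it has no edges, hence no monodromy.\<close>

definition bicolored_plane_tree :: "'v plane_graph \<Rightarrow> bool" where
  "bicolored_plane_tree T \<longleftrightarrow>
    finite (black T) \<and> finite (white T) \<and> black T \<inter> white T = {} \<and>
    edges T \<subseteq> black T \<times> white T \<and> edges T \<noteq> {} \<and>
    connected_graph T \<and> (\<nexists>p. is_cycle T p) \<and>
    (\<forall>v \<in> black T \<union> white T. cyclic_on (rot T v) (incident T v))"

definition passport :: "'v plane_graph \<Rightarrow> nat multiset \<times> nat multiset \<times> nat" where
  "passport T =
    (image_mset (vertex_degree T) (mset_set (black T)),
     image_mset (vertex_degree T) (mset_set (white T)),
     card (edges T))"

text \<open>
  The degrees of the black vertices met when going once around the white vertex \<open>w\<close>, starting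
  with the edge \<open>e\<close>.
\<close>

definition black_degrees_around :: "'v plane_graph \<Rightarrow> 'v \<Rightarrow> 'v \<times> 'v \<Rightarrow> nat list" where
  "black_degrees_around T w e =
    map (\<lambda>k. vertex_degree T (fst ((rot T w ^^ k) e))) [0..<vertex_degree T w]"


section \<open>The monodromy group\<close>

definition edge_labelling :: "'v plane_graph \<Rightarrow> (nat \<Rightarrow> 'v \<times> 'v) \<Rightarrow> bool" where
  "edge_labelling T lab \<longleftrightarrow> bij_betw lab {1..card (edges T)} (edges T)"

definition sigma_black :: "'v plane_graph \<Rightarrow> (nat \<Rightarrow> 'v \<times> 'v) \<Rightarrow> nat \<Rightarrow> nat" where
  "sigma_black T lab i =
    (if i \<in> {1..card (edges T)}
     then inv_into {1..card (edges T)} lab (rot T (fst (lab i)) (lab i)) else i)"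

definition sigma_white :: "'v plane_graph \<Rightarrow> (nat \<Rightarrow> 'v \<times> 'v) \<Rightarrow> nat \<Rightarrow> nat" where
  "sigma_white T lab i =
    (if i \<in> {1..card (edges T)}
     then inv_into {1..card (edges T)} lab (rot T (snd (lab i)) (lab i)) else i)"

definition monodromy_group ::
    "'v plane_graph \<Rightarrow> (nat \<Rightarrow> 'v \<times> 'v) \<Rightarrow> (nat \<Rightarrow> nat) monoid" where
  "monodromy_group T lab =
    subgroup_generated (sym_group (card (edges T))) {sigma_black T lab, sigma_white T lab}"


section \<open>Semidirect products and powers of groups\<close>

definition semidirect_product ::
    "('a, 'c) monoid_scheme \<Rightarrow> ('b, 'd) monoid_scheme \<Rightarrow> ('b \<Rightarrow> 'a \<Rightarrow> 'a) \<Rightarrow> ('a \<times> 'b) monoid" where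
  "semidirect_product N H \<phi> =
    \<lparr>carrier = carrier N \<times> carrier H,
     monoid.mult = (\<lambda>(x, h) (y, k). (x \<otimes>\<^bsub>N\<^esub> \<phi> h y, h \<otimes>\<^bsub>H\<^esub> k)),
     one = (\<one>\<^bsub>N\<^esub>, \<one>\<^bsub>H\<^esub>)\<rparr>"

definition iso_some_semidirect_product ::
    "('g, 'e) monoid_scheme \<Rightarrow> ('a, 'c) monoid_scheme \<Rightarrow> ('b, 'd) monoid_scheme \<Rightarrow> bool" where
  "iso_some_semidirect_product G N H \<longleftrightarrow>
    (\<exists>\<phi> \<in> hom H (AutoGroup N). G \<cong> semidirect_product N H \<phi>)"

definition group_power :: "('a, 'c) monoid_scheme \<Rightarrow> nat \<Rightarrow> (nat \<Rightarrow> 'a) monoid" where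
  "group_power G d = product_group {..<d} (\<lambda>_. G)"

end

theory Submission
  imports Defs
begin

text \<open>
  The edges at the four neighbours of the degree-\<open>4\<close> white vertex form four strands \<open>a\<close>, \<open>b\<close>, \<open>c\<close>,
  \<open>c'\<close> of lengths \<open>r\<close>, \<open>r\<close>, \<open>s\<close>, \<open>s\<close>, which \<open>\<sigma>\<^sub>0\<close> rotates, while \<open>\<sigma>\<^sub>1\<close> is the \<open>4\<close>-cycle on their first
  edges.  By the Chinese remainder theorem the conjugates of \<open>\<sigma>\<^sub>1\<close> under powers of \<open>\<sigma>\<^sub>0\<close> are all the
  \<open>4\<close>-cycles \<open>(a\<^sub>i b\<^sub>i c\<^sub>j c'\<^sub>j)\<close> with \<open>i \<equiv> j\<close> modulo \<open>d\<close>, so the edges of index divisible by \<open>d\<close> form a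
  block.  If \<open>s/d \<ge> 3\<close>, three of these \<open>4\<close>-cycles sharing \<open>a\<^sub>i\<close> and \<open>b\<^sub>i\<close> already yield a transposition,
  hence the full symmetric group of the block.  Otherwise \<open>s = 2r\<close>, the block has six points, and
  the group induced on it is the stabiliser of a \<open>1\<close>-factorisation of the complete graph on these
  points, which acts on the five factors as \<open>S\<^sub>5\<close>.  In both cases the block group \<open>K\<close> contains the
  restriction \<open>\<rho>\<close> of \<open>\<sigma>\<^sub>0\<^sup>d\<close> to the block, and \<open>t = \<sigma>\<^sub>0 \<rho>\<inverse>\<close> has order \<open>d\<close> and permutes the \<open>d\<close> translates
  of the block cyclically.  The monodromy group is generated by \<open>K\<close> and \<open>t\<close>, so it is the wreath
  product of \<open>K\<close> and \<open>\<int>\<^sub>d\<close>.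
\<close>

section \<open>Groups of permutations\<close>

text \<open>Subgroups are bare sets of bijections, with no fixed ambient symmetric group, so that
  groups supported on \<open>{1..n}\<close>, on a block or on six points can be compared by
  inclusion.\<close>

definition perm_subgroup :: "('a \<Rightarrow> 'a) set \<Rightarrow> bool" where
  "perm_subgroup S \<longleftrightarrow>
    id \<in> S \<and> (\<forall>f\<in>S. \<forall>g\<in>S. f \<circ> g \<in> S) \<and> (\<forall>f\<in>S. bij f \<and> inv' f \<in> S)"

definition perm_monoid :: "('a \<Rightarrow> 'a) set \<Rightarrow> ('a \<Rightarrow> 'a) monoid" where
  "perm_monoid S = \<lparr>carrier = S, monoid.mult = (\<circ>), one = id\<rparr>"

lemma perm_monoid_simps [simp]:
  "carrier (perm_monoid S) = S"
  "x \<otimes>\<^bsub>perm_monoid S\<^esub> y = x \<circ> y"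
  "\<one>\<^bsub>perm_monoid S\<^esub> = id"
  by (simp_all add: perm_monoid_def)

lemma perm_subgroup_id: "perm_subgroup S \<Longrightarrow> id \<in> S"
  and perm_subgroup_comp: "perm_subgroup S \<Longrightarrow> f \<in> S \<Longrightarrow> g \<in> S \<Longrightarrow> f \<circ> g \<in> S"
  and perm_subgroup_bij: "perm_subgroup S \<Longrightarrow> f \<in> S \<Longrightarrow> bij f"
  and perm_subgroup_inv: "perm_subgroup S \<Longrightarrow> f \<in> S \<Longrightarrow> inv' f \<in> S"
  by (simp_all add: perm_subgroup_def)

lemma perm_subgroup_funpow: "perm_subgroup S \<Longrightarrow> f \<in> S \<Longrightarrow> f ^^ k \<in> S"
  by (induction k) (auto intro: perm_subgroup_id perm_subgroup_comp)

lemma group_perm_monoid: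
  assumes "perm_subgroup S"
  shows "group (perm_monoid S)"
proof (rule groupI)
  fix f assume f: "f \<in> carrier (perm_monoid S)"
  then have "inv' f \<circ> f = id"
    using perm_subgroup_bij[OF assms, of f] by (simp add: bij_is_inj)
  with f show "\<exists>g\<in>carrier (perm_monoid S). g \<otimes>\<^bsub>perm_monoid S\<^esub> f = \<one>\<^bsub>perm_monoid S\<^esub>"
    using perm_subgroup_inv[OF assms, of f] by auto
qed (use assms in \<open>auto simp: comp_assoc intro: perm_subgroup_id perm_subgroup_comp\<close>)

lemma sym_group_eq_perm_monoid: "sym_group n = perm_monoid {p. p permutes {1..n}}"
  by (simp add: sym_group_def perm_monoid_def)

lemma perm_subgroup_permutes: "perm_subgroup {p. p permutes A}"
  by (auto simp: perm_subgroup_def permutes_id permutes_compose permutes_inv permutes_bij)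

text \<open>Relabelling along \<open>f\<close> is undone by relabelling along its inverse. This
  later identifies the symmetric group of a block with a standard \<open>sym_group\<close>.\<close>

lemma iso_perm_monoid_permutes:
  assumes "bij_betw f A B"
  shows "map_permutation A f \<in> iso (perm_monoid {p. p permutes A}) (perm_monoid {p. p permutes B})"
proof (rule isoI)
  have inj: "inj_on f A" and img: "f ` A = B"
    using assms by (auto simp: bij_betw_def)
  show "map_permutation A f \<in> hom (perm_monoid {p. p permutes A}) (perm_monoid {p. p permutes B})"
    using map_permutation_permutes[OF assms] map_permutation_compose'[OF inj] by (auto intro!: homI)
  have 1: "map_permutation B (inv_into A f) (map_permutation A f p) = p" if "p permutes A" for p
    using map_permutation_compose_inv[OF assms that] inj by simp
  have 2: "map_permutation A f (map_permutation B (inv_into A f) p) = p" if "p permutes B" for p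
    using map_permutation_compose_inv[OF bij_betw_inv_into[OF assms] that, of f]
    by (simp add: f_inv_into_f img)
  show "bij_betw (map_permutation A f) (carrier (perm_monoid {p. p permutes A}))
          (carrier (perm_monoid {p. p permutes B}))"
    by (rule bij_betwI[where g = "map_permutation B (inv_into A f)"])
       (use 1 2 map_permutation_permutes[OF assms]
          map_permutation_permutes[OF bij_betw_inv_into[OF assms]] in auto)
qed

lemma perm_subgroup_generate_sym_group:
  assumes "gens \<subseteq> carrier (sym_group n)"
  shows "perm_subgroup (generate (sym_group n) gens)"
proof -
  have gen: "subgroup (generate (sym_group n) gens) (sym_group n)"
    by (rule group.generate_is_subgroup[OF sym_group_is_group assms])
  have "bij f \<and> inv' f \<in> generate (sym_group n) gens" if "f \<in> generate (sym_group n) gens" for f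
  proof -
    have f: "f \<in> carrier (sym_group n)"
      using that subgroup.subset[OF gen] by auto
    then have "bij f"
      by (auto simp: sym_group_carrier permutes_bij)
    with f subgroup.m_inv_closed[OF gen that] show ?thesis by simp
  qed
  then show ?thesis
    using subgroup.one_closed[OF gen] subgroup.m_closed[OF gen]
    by (auto simp: perm_subgroup_def sym_group_def)
qed

lemma generate_sym_group_minimal:
  assumes "gens \<subseteq> carrier (sym_group n)" "perm_subgroup U" "gens \<subseteq> U"
  shows "generate (sym_group n) gens \<subseteq> U"
proof
  fix f assume "f \<in> generate (sym_group n) gens"
  then show "f \<in> U"
  proof (induction rule: generate.induct)
    case one
    then show ?case using assms(2) by (metis perm_subgroup_id sym_group_one)
  next
    case (incl h)
    then show ?case using assms(3) by auto
  next
    case (inv f)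
    then have "f \<in> carrier (sym_group n)" "f \<in> U" using assms by auto
    then show ?case using assms(2) by (simp add: perm_subgroup_inv)
  next
    case (eng h1 h2)
    then show ?case using assms(2) by (metis perm_subgroup_comp sym_group_mult)
  qed
qed

section \<open>Conjugation, transpositions and 4-cycles\<close>

lemma conj_transpose:
  assumes "bij f"
  shows "f \<circ> transpose a b \<circ> inv' f = transpose (f a) (f b)"
proof
  fix z
  obtain y where "z = f y"
    using assms by (metis bij_pointE)
  then show "(f \<circ> transpose a b \<circ> inv' f) z = transpose (f a) (f b) z"
    using assms by (auto simp: bij_is_inj transpose_def inj_eq)
qed

lemma conj_mem_perm_subgroup:
  assumes "perm_subgroup S" "f \<in> S" "g \<in> S"
  shows "f \<circ> g \<circ> inv' f \<in> S"
  using assms by (meson perm_subgroup_comp perm_subgroup_inv)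

text \<open>Conjugating \<open>(a b)\<close> by \<open>(b c)\<close> gives \<open>(a c)\<close>; if
  points coincide, the result is the identity or one of the given transpositions.\<close>

lemma transpose_mem_trans:
  assumes "perm_subgroup S" "transpose a b \<in> S" "transpose b c \<in> S"
  shows "transpose a c \<in> S"
proof (cases "a = b \<or> c = b")
  case True
  then show ?thesis using assms by auto
next
  case False
  have "transpose b c \<circ> transpose a b \<circ> inv' (transpose b c) \<in> S"
    using assms by (intro conj_mem_perm_subgroup)
  then have "transpose a c \<in> S"
    if "a \<noteq> c"
    using conj_transpose[of "transpose b c" a b] False that by simp
  then show ?thesis
    using assms(1) by (cases "a = c") (auto simp: perm_subgroup_id)
qed

text \<open>Any transposition \<open>(a b)\<close> is reached through the common point
  \<open>z\<close>, and transpositions generate the permutations of a finite set.\<close>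

lemma permutes_subset_perm_subgroup:
  assumes "perm_subgroup S" "finite A" "\<And>a. a \<in> A \<Longrightarrow> transpose z a \<in> S"
  shows "{p. p permutes A} \<subseteq> S"
proof clarify
  fix p assume "p permutes A"
  then show "p \<in> S"
    using assms(2)
  proof (induction rule: permutes_induct)
    case id
    then show ?case using assms(1) by (rule perm_subgroup_id)
  next
    case (swap a b p)
    have "transpose a b \<in> S"
      using transpose_mem_trans[OF assms(1)] assms(3) swap(1,2) by (metis transpose_commute)
    then show ?case using swap assms(1) by (intro perm_subgroup_comp)
  qed
qed

text \<open>For distinct points this is the cycle \<open>a -> b -> c -> d -> a\<close>. As a product
  of transpositions it can be inverted and conjugated factor by factor, even when points
  coincide.\<close>

definition four_cycle :: "'a \<Rightarrow> 'a \<Rightarrow> 'a \<Rightarrow> 'a \<Rightarrow> 'a \<Rightarrow> 'a" where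
  "four_cycle a b c d = transpose a b \<circ> transpose b c \<circ> transpose c d"

lemma four_cycle_apply:
  assumes "distinct [a, b, c, d]"
  shows "four_cycle a b c d a = b" "four_cycle a b c d b = c"
    "four_cycle a b c d c = d" "four_cycle a b c d d = a"
    "z \<noteq> a \<Longrightarrow> z \<noteq> b \<Longrightarrow> z \<noteq> c \<Longrightarrow> z \<noteq> d \<Longrightarrow> four_cycle a b c d z = z"
  using assms by (auto simp: four_cycle_def transpose_def)

lemma bij_four_cycle: "bij (four_cycle a b c d)"
  unfolding four_cycle_def by (intro bij_comp bij_transpose)

lemma inv_four_cycle: "inv' (four_cycle a b c d) = four_cycle d c b a"
  by (simp add: four_cycle_def o_inv_distrib bij_comp comp_assoc transpose_commute)

lemma conj_four_cycle:
  assumes "bij f"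
  shows "f \<circ> four_cycle a b c d \<circ> inv' f = four_cycle (f a) (f b) (f c) (f d)"
proof -
  have [simp]: "inv' f (f z) = z" for z using assms by (simp add: bij_is_inj)
  have "f \<circ> four_cycle a b c d \<circ> inv' f =
    (f \<circ> transpose a b \<circ> inv' f) \<circ> (f \<circ> transpose b c \<circ> inv' f) \<circ> (f \<circ> transpose c d \<circ> inv' f)"
    by (auto simp: four_cycle_def)
  then show ?thesis by (simp add: conj_transpose[OF assms] four_cycle_def)
qed

lemma four_cycle_permutes:
  assumes "{p, q, u, v} \<subseteq> A"
  shows "four_cycle p q u v permutes A"
  unfolding four_cycle_def using assms by (intro permutes_compose permutes_swap_id) auto

text \<open>The 4-cycles share the arc from \<open>a\<close> to \<open>b\<close> and are otherwise
  disjoint, which lets a word of length seven cancel everywhere except on \<open>c\<close> and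
  \<open>d\<close>.\<close>

lemma transpose_from_three_four_cycles:
  assumes S: "perm_subgroup S"
    and dist: "distinct [a, b, c, d, c', d', c'', d'']"
    and mem: "four_cycle a b c d \<in> S" "four_cycle a b c' d' \<in> S" "four_cycle a b c'' d'' \<in> S"
  shows "transpose c d \<in> S"
proof -
  let ?x = "four_cycle a b c d" and ?y = "four_cycle a b c' d'" and ?z = "four_cycle a b c'' d''"
  let ?x' = "four_cycle d c b a" and ?y' = "four_cycle d' c' b a" and ?z' = "four_cycle d'' c'' b a"
  have dist': "distinct [d'', c'', d', c', d, c, b, a]"
    using dist by auto
  \<comment> \<open>word found by a breadth-first search in the Cayley graph of \<open>S\<^sub>8\<close>\<close>
  have eq: "?x \<circ> (?y \<circ> (?x' \<circ> (?z \<circ> (?x \<circ> (?y' \<circ> ?z'))))) = transpose c d"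
  proof
    fix u
    show "(?x \<circ> (?y \<circ> (?x' \<circ> (?z \<circ> (?x \<circ> (?y' \<circ> ?z')))))) u = transpose c d u"
    proof (cases "u \<in> {a, b, c, d, c', d', c'', d''}")
      case True
      then show ?thesis
        using dist dist' by (elim insertE) (simp_all add: four_cycle_apply)
    next
      case False
      then show ?thesis
        using dist dist' by (simp add: four_cycle_apply)
    qed
  qed
  have "?x' \<in> S" "?y' \<in> S" "?z' \<in> S"
    using mem[THEN perm_subgroup_inv[OF S]] by (simp_all add: inv_four_cycle)
  then show ?thesis
    unfolding eq[symmetric] using mem by (intro perm_subgroup_comp[OF S])
qed

text \<open>Conjugation by the 4-cycle carries \<open>(c d)\<close> successively to
  \<open>(d a)\<close>, \<open>(a b)\<close> and \<open>(b c)\<close>; the diagonal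
  \<open>(a c)\<close> then follows by transitivity.\<close>

lemma transpose_from_four_cycle:
  assumes S: "perm_subgroup S" and dist: "distinct [a, b, c, d]"
    and mem: "four_cycle a b c d \<in> S" "transpose c d \<in> S"
  shows "transpose a b \<in> S" "transpose b c \<in> S" "transpose a c \<in> S" "transpose a d \<in> S"
proof -
  have step: "transpose (four_cycle a b c d u) (four_cycle a b c d v) \<in> S"
    if "transpose u v \<in> S" for u v
    using conj_mem_perm_subgroup[OF S mem(1) that] by (simp add: conj_transpose bij_four_cycle)
  have 1: "transpose a d \<in> S"
    using step[OF mem(2)] dist by (simp add: four_cycle_apply transpose_commute)
  show 2: "transpose a b \<in> S"
    using step[OF 1] dist by (simp add: four_cycle_apply transpose_commute)
  show "transpose b c \<in> S"
    using step[OF 2] dist by (simp add: four_cycle_apply)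
  with 2 show "transpose a c \<in> S"
    by (rule transpose_mem_trans[OF S])
  show "transpose a d \<in> S" by (rule 1)
qed


section \<open>Semidirect products and block systems\<close>

text \<open>Closure of \<open>P\<close> is all that is asked of it, so the lemma applies to a
  semidirect product without a prior proof of the group axioms.\<close>

lemma inv_into_iso:
  assumes f: "f \<in> iso P G"
    and closed: "\<And>x y. x \<in> carrier P \<Longrightarrow> y \<in> carrier P \<Longrightarrow> x \<otimes>\<^bsub>P\<^esub> y \<in> carrier P"
  shows "inv_into (carrier P) f \<in> iso G P"
proof -
  have hom: "f \<in> hom P G" and bij: "bij_betw f (carrier P) (carrier G)"
    using f by (auto simp: iso_def)
  let ?g = "inv_into (carrier P) f"
  have g: "?g a \<in> carrier P" "f (?g a) = a" if "a \<in> carrier G" for a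
    using bij that by (auto simp: bij_betw_def inv_into_into f_inv_into_f)
  have "?g \<in> hom G P"
  proof (rule homI)
    fix a b assume ab: "a \<in> carrier G" "b \<in> carrier G"
    then have "f (?g a \<otimes>\<^bsub>P\<^esub> ?g b) = a \<otimes>\<^bsub>G\<^esub> b"
      using g hom by (simp add: hom_mult)
    then show "?g (a \<otimes>\<^bsub>G\<^esub> b) = ?g a \<otimes>\<^bsub>P\<^esub> ?g b"
      using closed g ab bij by (metis bij_betw_inv_into_left)
  qed (use g in auto)
  then show ?thesis
    using bij by (simp add: iso_def bij_betw_inv_into)
qed

text \<open>Recognition of an internal semidirect product. \<open>normal\<close> says, without
  inverses, that conjugation by \<open>h k\<close> preserves the image of \<open>f\<close>;
  \<open>triv\<close> says that the two images meet trivially and, with \<open>x\<close> the unit,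
  that \<open>h\<close> is injective; \<open>surj\<close> says that their product is all of
  \<open>G\<close>.\<close>

lemma iso_some_semidirect_productI:
  assumes G: "group G" and N: "group N" and H: "group H"
    and f: "f \<in> hom N G" "inj_on f (carrier N)"
    and h: "h \<in> hom H G"
    and normal: "\<And>k x. k \<in> carrier H \<Longrightarrow> x \<in> carrier N \<Longrightarrow>
      \<exists>y\<in>carrier N. h k \<otimes>\<^bsub>G\<^esub> f x = f y \<otimes>\<^bsub>G\<^esub> h k"
    and triv: "\<And>k x. k \<in> carrier H \<Longrightarrow> x \<in> carrier N \<Longrightarrow>
      f x \<otimes>\<^bsub>G\<^esub> h k = \<one>\<^bsub>G\<^esub> \<Longrightarrow> k = \<one>\<^bsub>H\<^esub>"
    and surj: "\<And>g. g \<in> carrier G \<Longrightarrow>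
      \<exists>x\<in>carrier N. \<exists>k\<in>carrier H. g = f x \<otimes>\<^bsub>G\<^esub> h k"
  shows "iso_some_semidirect_product G N H"
proof -
  interpret G: group G by fact
  interpret N: group N by fact
  interpret H: group H by fact
  have fc: "f x \<in> carrier G" if "x \<in> carrier N" for x
    using f that by (auto simp: hom_def)
  have hc: "h k \<in> carrier G" if "k \<in> carrier H" for k
    using h that by (auto simp: hom_def)
  have fm: "f (x \<otimes>\<^bsub>N\<^esub> y) = f x \<otimes>\<^bsub>G\<^esub> f y" if "x \<in> carrier N" "y \<in> carrier N" for x y
    using f that by (auto simp: hom_def)
  have hm: "h (x \<otimes>\<^bsub>H\<^esub> y) = h x \<otimes>\<^bsub>G\<^esub> h y" if "x \<in> carrier H" "y \<in> carrier H" for x y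
    using h that by (auto simp: hom_def)
  have h1: "h \<one>\<^bsub>H\<^esub> = \<one>\<^bsub>G\<^esub>"
    using h hom_one[OF h H G] by simp
  \<comment> \<open>The action is conjugation pulled back through \<open>f\<close>. Injectivity of
    \<open>f\<close> makes the chosen \<open>y\<close> unique, and each law for
    \<open>\<phi>0\<close> is proved by exhibiting the right candidate.\<close>
  define \<phi>0 where "\<phi>0 k x = (SOME y. y \<in> carrier N \<and> h k \<otimes>\<^bsub>G\<^esub> f x = f y \<otimes>\<^bsub>G\<^esub> h k)" for k x
  have \<phi>0: "\<phi>0 k x \<in> carrier N" "h k \<otimes>\<^bsub>G\<^esub> f x = f (\<phi>0 k x) \<otimes>\<^bsub>G\<^esub> h k"
    if "k \<in> carrier H" "x \<in> carrier N" for k x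
    using someI_ex[of "\<lambda>y. y \<in> carrier N \<and> h k \<otimes>\<^bsub>G\<^esub> f x = f y \<otimes>\<^bsub>G\<^esub> h k"] normal[OF that]
    unfolding \<phi>0_def by blast+
  have \<phi>0_unique: "\<phi>0 k x = y"
    if "k \<in> carrier H" "x \<in> carrier N" "y \<in> carrier N"
      "h k \<otimes>\<^bsub>G\<^esub> f x = f y \<otimes>\<^bsub>G\<^esub> h k" for k x y
  proof -
    have "f (\<phi>0 k x) \<otimes>\<^bsub>G\<^esub> h k = f y \<otimes>\<^bsub>G\<^esub> h k"
      using \<phi>0[OF that(1,2)] that by simp
    then have "f (\<phi>0 k x) = f y"
      using that \<phi>0 fc hc by simp
    then show ?thesis
      using f(2) that \<phi>0 by (auto dest: inj_onD)
  qed
  have \<phi>0_mult: "\<phi>0 k (x \<otimes>\<^bsub>N\<^esub> y) = \<phi>0 k x \<otimes>\<^bsub>N\<^esub> \<phi>0 k y"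
    if k: "k \<in> carrier H" and x: "x \<in> carrier N" and y: "y \<in> carrier N" for k x y
  proof (rule \<phi>0_unique)
    have "h k \<otimes>\<^bsub>G\<^esub> f (x \<otimes>\<^bsub>N\<^esub> y) = (h k \<otimes>\<^bsub>G\<^esub> f x) \<otimes>\<^bsub>G\<^esub> f y"
      using k x y fc hc by (simp add: fm G.m_assoc)
    also have "\<dots> = f (\<phi>0 k x) \<otimes>\<^bsub>G\<^esub> (h k \<otimes>\<^bsub>G\<^esub> f y)"
      using k x y fc hc \<phi>0 by (simp add: G.m_assoc)
    also have "\<dots> = f (\<phi>0 k x \<otimes>\<^bsub>N\<^esub> \<phi>0 k y) \<otimes>\<^bsub>G\<^esub> h k"
      using k x y fc hc \<phi>0 by (simp add: fm G.m_assoc)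
    finally show "h k \<otimes>\<^bsub>G\<^esub> f (x \<otimes>\<^bsub>N\<^esub> y) = f (\<phi>0 k x \<otimes>\<^bsub>N\<^esub> \<phi>0 k y) \<otimes>\<^bsub>G\<^esub> h k" .
  qed (use k x y \<phi>0 in auto)
  have \<phi>0_comp: "\<phi>0 (k \<otimes>\<^bsub>H\<^esub> l) x = \<phi>0 k (\<phi>0 l x)"
    if k: "k \<in> carrier H" and l: "l \<in> carrier H" and x: "x \<in> carrier N" for k l x
  proof (rule \<phi>0_unique)
    have "h (k \<otimes>\<^bsub>H\<^esub> l) \<otimes>\<^bsub>G\<^esub> f x = h k \<otimes>\<^bsub>G\<^esub> (f (\<phi>0 l x) \<otimes>\<^bsub>G\<^esub> h l)"
      using k l x fc hc by (simp add: hm G.m_assoc \<phi>0)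
    also have "\<dots> = (h k \<otimes>\<^bsub>G\<^esub> f (\<phi>0 l x)) \<otimes>\<^bsub>G\<^esub> h l"
      using k l x fc hc \<phi>0(1) by (simp add: G.m_assoc)
    also have "\<dots> = f (\<phi>0 k (\<phi>0 l x)) \<otimes>\<^bsub>G\<^esub> h (k \<otimes>\<^bsub>H\<^esub> l)"
      using k l x fc hc \<phi>0 by (simp add: hm G.m_assoc)
    finally show "h (k \<otimes>\<^bsub>H\<^esub> l) \<otimes>\<^bsub>G\<^esub> f x = f (\<phi>0 k (\<phi>0 l x)) \<otimes>\<^bsub>G\<^esub> h (k \<otimes>\<^bsub>H\<^esub> l)" .
  qed (use k l x \<phi>0 in auto)
  have \<phi>0_one: "\<phi>0 \<one>\<^bsub>H\<^esub> x = x" if "x \<in> carrier N" for x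
    by (rule \<phi>0_unique) (use that fc h1 in auto)
  \<comment> \<open>The elements of \<open>AutoGroup N\<close> are extensional, hence the
    restriction to the carrier.\<close>
  define \<phi> where "\<phi> k = restrict (\<phi>0 k) (carrier N)" for k
  have \<phi>_auto: "\<phi> k \<in> auto N" if k: "k \<in> carrier H" for k
  proof -
    have "\<phi> k \<in> hom N N"
      using k \<phi>0 by (auto simp: \<phi>_def hom_def \<phi>0_mult)
    moreover have "bij_betw (\<phi> k) (carrier N) (carrier N)"
    proof (rule bij_betwI[where g = "\<phi> (inv\<^bsub>H\<^esub> k)"])
      show "\<phi> (inv\<^bsub>H\<^esub> k) (\<phi> k x) = x" if "x \<in> carrier N" for x
        using k that \<phi>0 \<phi>0_comp[of "inv\<^bsub>H\<^esub> k" k x] \<phi>0_one by (simp add: \<phi>_def)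
      show "\<phi> k (\<phi> (inv\<^bsub>H\<^esub> k) x) = x" if "x \<in> carrier N" for x
        using k that \<phi>0 \<phi>0_comp[of k "inv\<^bsub>H\<^esub> k" x] \<phi>0_one by (simp add: \<phi>_def)
    qed (use k \<phi>0 in \<open>auto simp: \<phi>_def\<close>)
    ultimately show ?thesis
      by (auto simp: auto_def Bij_def \<phi>_def)
  qed
  have "\<phi> \<in> hom H (AutoGroup N)"
  proof (rule homI)
    fix k l assume kl: "k \<in> carrier H" "l \<in> carrier H"
    then have "\<phi> k \<in> Bij (carrier N)" "\<phi> l \<in> Bij (carrier N)"
      using \<phi>_auto by (auto simp: auto_def)
    then show "\<phi> (k \<otimes>\<^bsub>H\<^esub> l) = \<phi> k \<otimes>\<^bsub>AutoGroup N\<^esub> \<phi> l"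
      using kl \<phi>0 by (auto simp: AutoGroup_def BijGroup_def compose_def \<phi>_def \<phi>0_comp)
  qed (use \<phi>_auto in \<open>auto simp: AutoGroup_def\<close>)
  moreover have "G \<cong> semidirect_product N H \<phi>"
  proof -
    let ?P = "semidirect_product N H \<phi>"
    let ?F = "\<lambda>(x, k). f x \<otimes>\<^bsub>G\<^esub> h k"
    have P: "carrier ?P = carrier N \<times> carrier H"
      by (simp add: semidirect_product_def)
    have "?F \<in> hom ?P G"
    proof (rule homI)
      fix p q assume "p \<in> carrier ?P" "q \<in> carrier ?P"
      then obtain x k y l where pq: "p = (x, k)" "q = (y, l)"
        "x \<in> carrier N" "k \<in> carrier H" "y \<in> carrier N" "l \<in> carrier H"
        by (auto simp: P)
      have "?F (p \<otimes>\<^bsub>?P\<^esub> q) = f x \<otimes>\<^bsub>G\<^esub> (f (\<phi>0 k y) \<otimes>\<^bsub>G\<^esub> h k) \<otimes>\<^bsub>G\<^esub> h l"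
        using pq fc hc \<phi>0 by (simp add: semidirect_product_def \<phi>_def fm hm G.m_assoc)
      also have "\<dots> = f x \<otimes>\<^bsub>G\<^esub> (h k \<otimes>\<^bsub>G\<^esub> f y) \<otimes>\<^bsub>G\<^esub> h l"
        using pq by (simp add: \<phi>0)
      also have "\<dots> = ?F p \<otimes>\<^bsub>G\<^esub> ?F q"
        using pq fc hc by (simp add: G.m_assoc)
      finally show "?F (p \<otimes>\<^bsub>?P\<^esub> q) = ?F p \<otimes>\<^bsub>G\<^esub> ?F q" .
    qed (auto simp: P fc hc)
    moreover have "inj_on ?F (carrier ?P)"
    proof (rule inj_onI)
      fix p q assume "p \<in> carrier ?P" "q \<in> carrier ?P" and eq: "?F p = ?F q"
      then obtain x k y l where pq: "p = (x, k)" "q = (y, l)"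
        "x \<in> carrier N" "k \<in> carrier H" "y \<in> carrier N" "l \<in> carrier H"
        by (auto simp: P)
      have finv: "f (inv\<^bsub>N\<^esub> y) = inv\<^bsub>G\<^esub> f y" and hinv: "h (inv\<^bsub>H\<^esub> l) = inv\<^bsub>G\<^esub> h l"
        using pq f(1) h N H G group_hom.hom_inv
        by (metis group_hom.intro group_hom_axioms.intro)+
      \<comment> \<open>Moving everything to one side gives an equation of the shape to which
        \<open>triv\<close> applies.\<close>
      have "f (inv\<^bsub>N\<^esub> y \<otimes>\<^bsub>N\<^esub> x) \<otimes>\<^bsub>G\<^esub> h (k \<otimes>\<^bsub>H\<^esub> inv\<^bsub>H\<^esub> l)
          = inv\<^bsub>G\<^esub> f y \<otimes>\<^bsub>G\<^esub> (f x \<otimes>\<^bsub>G\<^esub> h k) \<otimes>\<^bsub>G\<^esub> inv\<^bsub>G\<^esub> h l"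
        using pq fc hc by (simp add: fm hm finv hinv G.m_assoc)
      also have "\<dots> = inv\<^bsub>G\<^esub> f y \<otimes>\<^bsub>G\<^esub> (f y \<otimes>\<^bsub>G\<^esub> h l) \<otimes>\<^bsub>G\<^esub> inv\<^bsub>G\<^esub> h l"
        using eq pq by simp
      also have "\<dots> = \<one>\<^bsub>G\<^esub>"
        using pq fc hc by (simp add: G.m_assoc[symmetric] G.inv_solve_left')
      finally have "k \<otimes>\<^bsub>H\<^esub> inv\<^bsub>H\<^esub> l = \<one>\<^bsub>H\<^esub>"
        using pq by (intro triv[of _ "inv\<^bsub>N\<^esub> y \<otimes>\<^bsub>N\<^esub> x"]) auto
      then have kl: "k = l"
        using pq by (metis H.inv_equality H.inv_inv H.inv_closed)
      then have "f x = f y"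
        using eq pq fc hc by simp
      then have "x = y"
        using f(2) pq by (auto dest: inj_onD)
      with kl pq show "p = q" by simp
    qed
    moreover have "?F ` carrier ?P = carrier G"
    proof
      show "?F ` carrier ?P \<subseteq> carrier G" by (auto simp: P fc hc)
      show "carrier G \<subseteq> ?F ` carrier ?P"
        using surj by (fastforce simp: P)
    qed
    ultimately have "?F \<in> iso ?P G"
      by (simp add: iso_def bij_betw_def)
    moreover have "x \<otimes>\<^bsub>?P\<^esub> y \<in> carrier ?P" if "x \<in> carrier ?P" "y \<in> carrier ?P" for x y
      using that \<phi>0 by (auto simp: semidirect_product_def \<phi>_def)
    ultimately have "inv_into (carrier ?P) ?F \<in> iso G ?P"
      by (rule inv_into_iso)
    then show ?thesis
      by (rule is_isoI)
  qed
  ultimately show ?thesis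
    unfolding iso_some_semidirect_product_def by blast
qed

text \<open>The setting of a wreath product of \<open>K\<close> by a cyclic group: \<open>K\<close>
  acts on one block, and \<open>t\<close> moves this block through \<open>d\<close> translates.
  Disjointness is demanded from \<open>B\<close> itself only; as the powers of \<open>t\<close> are
  injective, the translates are then pairwise disjoint.\<close>

locale rotated_blocks =
  fixes t :: "'a \<Rightarrow> 'a" and d :: nat and B :: "'a set" and K :: "('a \<Rightarrow> 'a) set"
  assumes d_pos: "0 < d"
    and bij_t: "bij t"
    and t_period: "t ^^ d = id"
    and B_nonempty: "B \<noteq> {}"
    and B_disjoint: "\<And>j. 0 < j \<Longrightarrow> j < d \<Longrightarrow> (t ^^ j) ` B \<inter> B = {}"
    and K: "perm_subgroup K"
    and K_permutes: "\<And>f. f \<in> K \<Longrightarrow> f permutes B"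
begin

lemma bij_t_pow: "bij (t ^^ j)"
  using bij_t by (rule bij_betw_funpow)

lemma inj_t_pow_iff [simp]: "(t ^^ j) a = (t ^^ j) b \<longleftrightarrow> a = b"
  using bij_t_pow[of j] by (auto simp: bij_def inj_eq)

lemma blocks_disjoint:
  assumes "i < d" "j < d" "a \<in> B" "b \<in> B" "(t ^^ i) a = (t ^^ j) b"
  shows "i = j \<and> a = b"
  using assms
proof (induction i j arbitrary: a b rule: linorder_wlog)
  case (le i j)
  then have "(t ^^ i) a = (t ^^ i) ((t ^^ (j - i)) b)"
    by (simp flip: funpow_add comp_apply[of "t ^^ i"])
  then have "a = (t ^^ (j - i)) b"
    by simp
  then have "j - i = 0"
    using B_disjoint[of "j - i"] le by force
  with le show ?case by simp
next
  case (sym i j)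
  then show ?case by metis
qed

definition conj_pow :: "nat \<Rightarrow> ('a \<Rightarrow> 'a) \<Rightarrow> 'a \<Rightarrow> 'a" where
  "conj_pow j f = (t ^^ j) \<circ> f \<circ> inv' (t ^^ j)"

lemma conj_pow_apply [simp]: "conj_pow j f ((t ^^ j) b) = (t ^^ j) (f b)"
  using bij_t_pow[of j] by (simp add: conj_pow_def bij_is_inj)

lemma conj_pow_outside:
  assumes "f \<in> K" "z \<notin> (t ^^ j) ` B"
  shows "conj_pow j f z = z"
proof -
  obtain y where "z = (t ^^ j) y"
    using bij_t_pow[of j] by (metis bij_pointE)
  moreover from this have "f y = y"
    using assms K_permutes[of f] by (auto simp: permutes_def)
  ultimately show ?thesis by simp
qed

text \<open>The element of the base group \<open>K^d\<close> with \<open>x j\<close> acting on the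
  translate by \<open>t ^^ j\<close>. The number of factors is a parameter to allow induction on it;
  \<open>d\<close> factors fill all blocks.\<close>

primrec block_prod :: "nat \<Rightarrow> (nat \<Rightarrow> 'a \<Rightarrow> 'a) \<Rightarrow> 'a \<Rightarrow> 'a" where
  "block_prod 0 x = id"
| "block_prod (Suc m) x = block_prod m x \<circ> conj_pow m (x m)"

lemma block_prod_outside:
  assumes "\<And>j. x j \<in> K" "\<And>j. j < m \<Longrightarrow> z \<notin> (t ^^ j) ` B"
  shows "block_prod m x z = z"
  using assms by (induction m) (auto simp: conj_pow_outside)

lemma block_prod_later:
  assumes "\<And>j. x j \<in> K" "m \<le> j" "j < d" "b \<in> B"
  shows "block_prod m x ((t ^^ j) b) = (t ^^ j) b"
proof (rule block_prod_outside)
  fix i assume "i < m"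
  then show "(t ^^ j) b \<notin> (t ^^ i) ` B"
    using assms blocks_disjoint[of j i b] by fastforce
qed (fact assms)

lemma block_prod_apply:
  assumes "\<And>j. x j \<in> K" "m \<le> d" "j < m" "b \<in> B"
  shows "block_prod m x ((t ^^ j) b) = (t ^^ j) (x j b)"
  using assms
proof (induction m)
  case (Suc m)
  have xb: "x j b \<in> B"
    using Suc.prems K_permutes by (simp add: permutes_in_image)
  show ?case
  proof (cases "j = m")
    case True
    then show ?thesis
      using Suc.prems xb by (simp add: block_prod_later)
  next
    case False
    then have "conj_pow m (x m) ((t ^^ j) b) = (t ^^ j) b"
      using Suc.prems blocks_disjoint[of j m b] by (intro conj_pow_outside) fastforce+
    then show ?thesis
      using Suc False by simp
  qed
qed simp

lemma block_ext:
  assumes "\<And>j b. j < d \<Longrightarrow> b \<in> B \<Longrightarrow> f ((t ^^ j) b) = g ((t ^^ j) b)"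
    and "\<And>z. (\<And>j. j < d \<Longrightarrow> z \<notin> (t ^^ j) ` B) \<Longrightarrow> f z = g z"
  shows "f = g"
proof
  fix z
  show "f z = g z"
    using assms by (cases "\<exists>j<d. z \<in> (t ^^ j) ` B") auto
qed

lemma block_prod_comp:
  assumes x: "\<And>j. x j \<in> K" and y: "\<And>j. y j \<in> K"
  shows "block_prod d (\<lambda>j. x j \<circ> y j) = block_prod d x \<circ> block_prod d y"
proof (rule block_ext)
  have xy: "\<And>j. x j \<circ> y j \<in> K"
    using x y by (intro perm_subgroup_comp K)
  show "block_prod d (\<lambda>j. x j \<circ> y j) ((t ^^ j) b) = (block_prod d x \<circ> block_prod d y) ((t ^^ j) b)"
    if "j < d" "b \<in> B" for j b
  proof -
    have "y j b \<in> B"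
      using that y K_permutes by (simp add: permutes_in_image)
    then show ?thesis
      using that by (simp add: block_prod_apply x y xy)
  qed
  show "block_prod d (\<lambda>j. x j \<circ> y j) z = (block_prod d x \<circ> block_prod d y) z"
    if "\<And>j. j < d \<Longrightarrow> z \<notin> (t ^^ j) ` B" for z
    using that by (simp add: block_prod_outside x y xy)
qed

lemma block_prod_id: "block_prod d (\<lambda>j. id) = id"
  by (rule block_ext) (simp_all add: block_prod_apply block_prod_outside perm_subgroup_id K)

lemma block_prod_inj:
  assumes x: "\<And>j. x j \<in> K" and y: "\<And>j. y j \<in> K"
    and eq: "block_prod d x = block_prod d y" and j: "j < d"
  shows "x j = y j"
proof
  fix b
  show "x j b = y j b"
  proof (cases "b \<in> B")
    case True
    then have "(t ^^ j) (x j b) = (t ^^ j) (y j b)"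
      using block_prod_apply[of x d j b] block_prod_apply[of y d j b] x y eq j by simp
    then show ?thesis by simp
  next
    case False
    then show ?thesis
      using x y K_permutes by (metis permutes_not_in)
  qed
qed

lemma block_prod_single:
  assumes "f \<in> K"
  shows "block_prod d (\<lambda>j. if j = 0 then f else id) = f"
proof (rule block_ext)
  have K': "(if j = 0 then f else id) \<in> K" for j :: nat
    using assms by (simp add: perm_subgroup_id K)
  show "block_prod d (\<lambda>j. if j = 0 then f else id) ((t ^^ j) b) = f ((t ^^ j) b)"
    if "j < d" "b \<in> B" for j b
  proof (cases "j = 0")
    case False
    then have "(t ^^ j) b \<notin> B"
      using that B_disjoint[of j] by blast
    then show ?thesis
      using that False K_permutes[OF assms] by (simp add: block_prod_apply K' permutes_not_in)
  qed (use block_prod_apply[of "\<lambda>j. if j = 0 then f else id" d 0 b] that d_pos in \<open>simp add: K'\<close>)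
  show "block_prod d (\<lambda>j. if j = 0 then f else id) z = f z"
    if "\<And>j. j < d \<Longrightarrow> z \<notin> (t ^^ j) ` B" for z
    using that[of 0] that d_pos K_permutes[OF assms]
    by (simp add: block_prod_outside K' permutes_not_in)
qed

text \<open>The effect on coordinates of conjugation by \<open>t\<close>. Adding
  \<open>d - 1\<close> replaces subtracting \<open>1\<close>, so that index \<open>0\<close>
  receives the coordinate of index \<open>d - 1\<close>.\<close>

definition shift :: "(nat \<Rightarrow> 'a \<Rightarrow> 'a) \<Rightarrow> nat \<Rightarrow> 'a \<Rightarrow> 'a" where
  "shift x j = x ((j + d - 1) mod d)"

lemma t_block_prod:
  assumes x: "\<And>j. x j \<in> K"
  shows "t \<circ> block_prod d x = block_prod d (shift x) \<circ> t"
proof (rule block_ext)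
  have sx: "\<And>j. shift x j \<in> K"
    by (simp add: shift_def x)
  show "(t \<circ> block_prod d x) ((t ^^ j) b) = (block_prod d (shift x) \<circ> t) ((t ^^ j) b)"
    if j: "j < d" and b: "b \<in> B" for j b
  proof (cases "Suc j = d")
    case True
    \<comment> \<open>From the last block \<open>t\<close> returns to \<open>B\<close>, because
      \<open>t ^^ d = id\<close>; this is the wraparound built into \<open>shift\<close>.\<close>
    have "t ((t ^^ j) b) = (t ^^ 0) b" "t ((t ^^ j) (x j b)) = (t ^^ 0) (x j b)"
      using t_period unfolding True[symmetric] by (auto simp: fun_eq_iff)
    moreover have "shift x 0 = x j"
      using True by (auto simp: shift_def)
    ultimately show ?thesis
      using block_prod_apply[of "shift x" d 0 b] block_prod_apply[of x d j b] x sx j b by simp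
  next
    case False
    then have "shift x (Suc j) = x j"
      using j by (simp add: shift_def)
    then show ?thesis
      using False block_prod_apply[of "shift x" d "Suc j" b] block_prod_apply[of x d j b] x sx j b
      by simp
  qed
  show "(t \<circ> block_prod d x) z = (block_prod d (shift x) \<circ> t) z"
    if z: "\<And>j. j < d \<Longrightarrow> z \<notin> (t ^^ j) ` B" for z
  proof -
    have "t z \<notin> (t ^^ j) ` B" if j: "j < d" for j
    proof
      assume "t z \<in> (t ^^ j) ` B"
      then obtain b where b: "b \<in> B" "t z = (t ^^ j) b" by blast
      \<comment> \<open>\<open>i\<close> is the predecessor of \<open>j\<close> modulo
        \<open>d\<close>; it shows that \<open>t\<close> maps points outside all translates to such
        points.\<close>
      define i where "i = (if j = 0 then d - 1 else j - 1)"
      have "(t ^^ Suc i) b = (t ^^ j) b"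
        using d_pos by (cases "j = 0") (simp_all add: i_def t_period del: funpow.simps(2))
      then have "z = (t ^^ i) b"
        using b inj_t_pow_iff[of 1 z "(t ^^ i) b"] by simp
      moreover have "i < d"
        using j by (auto simp: i_def)
      ultimately show False
        using z b by blast
    qed
    with z show ?thesis by (simp add: block_prod_outside x sx)
  qed
qed

lemma shift_pow_mem: "(\<And>j. x j \<in> K) \<Longrightarrow> (shift ^^ k) x j \<in> K"
  by (induction k arbitrary: j) (simp_all add: shift_def)

lemma t_pow_block_prod:
  assumes x: "\<And>j. x j \<in> K"
  shows "(t ^^ k) \<circ> block_prod d x = block_prod d ((shift ^^ k) x) \<circ> (t ^^ k)"
proof (induction k)
  case (Suc k)
  have "(t ^^ Suc k) \<circ> block_prod d x = t \<circ> ((t ^^ k) \<circ> block_prod d x)"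
    by (simp add: comp_assoc)
  also have "\<dots> = (t \<circ> block_prod d ((shift ^^ k) x)) \<circ> (t ^^ k)"
    by (simp only: Suc comp_assoc)
  also have "\<dots> = block_prod d ((shift ^^ Suc k) x) \<circ> (t ^^ Suc k)"
    by (simp add: t_block_prod shift_pow_mem x comp_assoc)
  finally show ?case .
qed simp

lemma t_pow_mod: "t ^^ (k mod d) = t ^^ k"
proof -
  have "t ^^ k = t ^^ (k mod d + d * (k div d))" by simp
  also have "\<dots> = t ^^ (k mod d) \<circ> (t ^^ d) ^^ (k div d)"
    by (simp only: funpow_add funpow_mult mult.commute)
  finally show ?thesis
    by (simp add: t_period)
qed

text \<open>The wreath product in normal form, a base element times a power of \<open>t\<close>. It
  is closed under composition because a power of \<open>t\<close> passes a base element at the cost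
  of a shift.\<close>

definition block_group :: "('a \<Rightarrow> 'a) set" where
  "block_group = {block_prod d x \<circ> (t ^^ k) | x k. \<forall>j. x j \<in> K}"

lemma block_groupI: "(\<And>j. x j \<in> K) \<Longrightarrow> block_prod d x \<circ> (t ^^ k) \<in> block_group"
  by (auto simp: block_group_def)

lemma perm_subgroup_block_group: "perm_subgroup block_group"
  unfolding perm_subgroup_def
proof (intro conjI ballI)
  show "id \<in> block_group"
    using block_groupI[of "\<lambda>j. id" 0] by (simp add: block_prod_id perm_subgroup_id K)
  fix f assume "f \<in> block_group"
  then obtain x k where f: "f = block_prod d x \<circ> (t ^^ k)" and x: "\<And>j. x j \<in> K"
    by (auto simp: block_group_def)
  show "f \<circ> g \<in> block_group" if "g \<in> block_group" for g
  proof -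
    from that obtain y l where g: "g = block_prod d y \<circ> (t ^^ l)" and y: "\<And>j. y j \<in> K"
      by (auto simp: block_group_def)
    let ?y = "(shift ^^ k) y"
    have "f \<circ> g = block_prod d x \<circ> (t ^^ k \<circ> block_prod d y) \<circ> t ^^ l"
      by (simp add: f g comp_assoc)
    also have "\<dots> = (block_prod d x \<circ> block_prod d ?y) \<circ> (t ^^ k \<circ> t ^^ l)"
      by (simp add: t_pow_block_prod y comp_assoc)
    also have "\<dots> = block_prod d (\<lambda>j. x j \<circ> ?y j) \<circ> t ^^ (k + l)"
      by (simp add: block_prod_comp x y shift_pow_mem funpow_add)
    also have "\<dots> \<in> block_group"
      by (intro block_groupI perm_subgroup_comp K x shift_pow_mem y)
    finally show ?thesis .
  qed
  define x' where "x' j = inv' (x j)" for j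
  have x': "x' j \<in> K" for j
    unfolding x'_def by (intro perm_subgroup_inv K x)
  have "x j \<circ> x' j = id" "x' j \<circ> x j = id" for j
    using perm_subgroup_bij[OF K x[of j]] by (simp_all add: x'_def bij_is_inj bij_is_surj surj_iff[symmetric])
  then have inv1: "block_prod d x \<circ> block_prod d x' = id" "block_prod d x' \<circ> block_prod d x = id"
    using block_prod_comp[of x x', OF x x'] block_prod_comp[of x' x, OF x' x]
    by (simp_all add: block_prod_id)
  \<comment> \<open>\<open>k + l\<close> is the multiple \<open>k * d\<close> of the period, so
    \<open>t ^^ l\<close> inverts \<open>t ^^ k\<close> with a natural exponent.\<close>
  define l where "l = k * (d - 1)"
  have "k + l = k * d"
    using d_pos by (cases d) (simp_all add: l_def)
  then have "t ^^ (k + l) = id"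
    using t_pow_mod[of "k * d"] by simp
  then have inv2: "t ^^ k \<circ> t ^^ l = id" "t ^^ l \<circ> t ^^ k = id"
    by (simp_all add: funpow_add[symmetric] add.commute)
  let ?g = "t ^^ l \<circ> block_prod d x'"
  have "f \<circ> ?g = block_prod d x \<circ> (t ^^ k \<circ> t ^^ l) \<circ> block_prod d x'"
    by (simp add: f comp_assoc)
  then have 1: "f \<circ> ?g = id"
    by (simp add: inv1 inv2)
  have "?g \<circ> f = t ^^ l \<circ> (block_prod d x' \<circ> block_prod d x) \<circ> t ^^ k"
    by (simp add: f comp_assoc)
  then have 2: "?g \<circ> f = id"
    by (simp add: inv1 inv2)
  show "bij f"
    by (rule o_bij[OF 2 1])
  have "inv' f = ?g"
    using 1 2 by (intro inv_unique_comp)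
  then show "inv' f \<in> block_group"
    using x' by (simp add: t_pow_block_prod block_groupI shift_pow_mem)
qed

lemma t_mem_block_group: "t \<in> block_group"
  using block_groupI[of "\<lambda>j. id" 1] by (simp add: block_prod_id perm_subgroup_id K)

lemma K_subset_block_group: "K \<subseteq> block_group"
proof
  fix f assume "f \<in> K"
  then show "f \<in> block_group"
    using block_groupI[of "\<lambda>j. if j = 0 then f else id" 0]
    by (simp add: block_prod_single perm_subgroup_id K)
qed

lemma block_prod_mem:
  assumes S: "perm_subgroup S" "K \<subseteq> S" "t \<in> S" and x: "\<And>j. x j \<in> K"
  shows "block_prod m x \<in> S"
proof (induction m)
  case 0
  show ?case
    unfolding block_prod.simps by (rule perm_subgroup_id[OF S(1)])
next
  case (Suc m)
  have "conj_pow m (x m) \<in> S"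
    unfolding conj_pow_def using S x by (intro conj_mem_perm_subgroup perm_subgroup_funpow) auto
  with Suc S show ?case
    unfolding block_prod.simps by (intro perm_subgroup_comp)
qed

text \<open>\<open>minimal\<close> states that \<open>K\<close> and \<open>t\<close> generate
  \<open>S\<close>; applied to \<open>block_group\<close> it brings every element into normal form.
  \<open>Q\<close> is an abstract copy of \<open>K\<close>, so that the conclusion can speak of a
  standard symmetric group.\<close>

lemma iso_some_semidirect_block_group:
  assumes S: "perm_subgroup S" "K \<subseteq> S" "t \<in> S"
    and minimal: "\<And>U. perm_subgroup U \<Longrightarrow> K \<subseteq> U \<Longrightarrow> t \<in> U \<Longrightarrow> S \<subseteq> U"
    and Q: "group Q" and \<iota>: "\<iota> \<in> iso Q (perm_monoid K)"
  shows "iso_some_semidirect_product (perm_monoid S) (group_power Q d) (integer_mod_group d)"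
proof (rule iso_some_semidirect_productI)
  have \<iota>_mult: "\<iota> (a \<otimes>\<^bsub>Q\<^esub> b) = \<iota> a \<circ> \<iota> b" if "a \<in> carrier Q" "b \<in> carrier Q" for a b
    using \<iota> that by (auto simp: iso_def hom_def)
  have \<iota>_bij: "bij_betw \<iota> (carrier Q) K"
    using \<iota> by (simp add: iso_def)
  then have \<iota>K: "\<iota> a \<in> K" if "a \<in> carrier Q" for a
    using that by (auto simp: bij_betw_def)
  let ?N = "group_power Q d" and ?H = "integer_mod_group d" and ?G = "perm_monoid S"
  \<comment> \<open>Members of the power are undefined from \<open>d\<close> on; the value
    \<open>id\<close> there makes \<open>ext x\<close> a total family in \<open>K\<close>, as the
    lemmas on \<open>block_prod\<close> require.\<close>
  define ext where "ext x j = (if j < d then \<iota> (x j) else id)" for x j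
  define f where "f x = block_prod d (ext x)" for x
  define h where "h k = t ^^ nat k" for k
  have N_carrier: "carrier ?N = (\<Pi>\<^sub>E j\<in>{..<d}. carrier Q)"
    by (simp add: group_power_def)
  have H_carrier: "carrier ?H = {0..<int d}"
    using d_pos by (simp add: carrier_integer_mod_group)
  have extK: "ext x j \<in> K" if "x \<in> carrier ?N" for x j
    using that by (auto simp: ext_def N_carrier perm_subgroup_id K intro!: \<iota>K)
  have lift: "\<exists>x\<in>carrier ?N. block_prod d y = f x" if y: "\<And>j. y j \<in> K" for y
  proof
    let ?x = "\<lambda>j\<in>{..<d}. inv_into (carrier Q) \<iota> (y j)"
    show x: "?x \<in> carrier ?N"
      using y \<iota>_bij by (auto simp: N_carrier bij_betw_def intro!: inv_into_into)
    have "ext ?x j = y j" if "j < d" for j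
      using that y \<iota>_bij by (simp add: ext_def f_inv_into_f bij_betw_def)
    then show "block_prod d y = f ?x"
      unfolding f_def by (intro block_ext) (simp_all add: block_prod_apply block_prod_outside extK[OF x] y)
  qed
  show "group ?G" "group ?N" "group ?H"
    using S(1) Q by (simp_all add: group_perm_monoid group_power_def)
  show "f \<in> hom ?N ?G"
  proof (rule homI)
    fix x y assume xy: "x \<in> carrier ?N" "y \<in> carrier ?N"
    then have "ext (x \<otimes>\<^bsub>?N\<^esub> y) = (\<lambda>j. ext x j \<circ> ext y j)"
      by (auto simp: ext_def group_power_def fun_eq_iff \<iota>_mult PiE_iff)
    then show "f (x \<otimes>\<^bsub>?N\<^esub> y) = f x \<otimes>\<^bsub>?G\<^esub> f y"
      using xy by (simp add: f_def block_prod_comp extK)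
  qed (simp add: f_def block_prod_mem S extK)
  show "inj_on f (carrier ?N)"
  proof (rule inj_onI)
    fix x y assume xy: "x \<in> carrier ?N" "y \<in> carrier ?N" "f x = f y"
    have "x j = y j" if "j < d" for j
    proof -
      have "ext x j = ext y j"
        using xy that by (intro block_prod_inj[of "ext x" "ext y"]) (simp_all add: f_def extK)
      then have "\<iota> (x j) = \<iota> (y j)"
        using that by (simp add: ext_def)
      then show ?thesis
        using xy \<iota>_bij that by (auto simp: N_carrier bij_betw_def PiE_iff dest: inj_onD)
    qed
    then show "x = y"
      using xy(1,2) unfolding N_carrier by (intro PiE_ext[of x _ _ y]) auto
  qed
  show "h \<in> hom ?H ?G"
  proof (rule homI)
    fix k l assume "k \<in> carrier ?H" "l \<in> carrier ?H"
    then have "nat ((k + l) mod int d) = (nat k + nat l) mod d"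
      by (simp add: H_carrier nat_mod_distrib nat_add_distrib)
    then show "h (k \<otimes>\<^bsub>?H\<^esub> l) = h k \<otimes>\<^bsub>?G\<^esub> h l"
      by (simp add: h_def t_pow_mod funpow_add)
  qed (use S in \<open>simp add: h_def perm_subgroup_funpow\<close>)
  show "\<exists>y\<in>carrier ?N. h k \<otimes>\<^bsub>?G\<^esub> f x = f y \<otimes>\<^bsub>?G\<^esub> h k"
    if "k \<in> carrier ?H" "x \<in> carrier ?N" for k x
    using lift[of "(shift ^^ nat k) (ext x)"] that
    by (auto simp: f_def h_def t_pow_block_prod extK shift_pow_mem)
  show "k = \<one>\<^bsub>?H\<^esub>"
    if k: "k \<in> carrier ?H" and x: "x \<in> carrier ?N" and eq: "f x \<otimes>\<^bsub>?G\<^esub> h k = \<one>\<^bsub>?G\<^esub>" for k x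
  proof (rule ccontr)
    assume "k \<noteq> \<one>\<^bsub>?H\<^esub>"
    with k have kd: "0 < nat k" "nat k < d"
      by (auto simp: H_carrier)
    obtain b where b: "b \<in> B"
      using B_nonempty by blast
    \<comment> \<open>A base element preserves every translate, so its product with
      \<open>t ^^ k\<close> for \<open>0 < k < d\<close> moves \<open>B\<close> off itself and
      cannot be the identity.\<close>
    have "b = f x (h k b)"
      using eq by (simp add: fun_eq_iff)
    also have "\<dots> = (t ^^ nat k) (ext x (nat k) b)"
      using kd b extK[OF x] by (simp add: f_def h_def block_prod_apply)
    also have "\<dots> \<in> (t ^^ nat k) ` B"
      using b extK[OF x] K_permutes by (intro imageI) (simp add: permutes_in_image)
    finally show False
      using b B_disjoint[OF kd] by blast
  qed
  show "\<exists>x\<in>carrier ?N. \<exists>k\<in>carrier ?H. g = f x \<otimes>\<^bsub>?G\<^esub> h k" if "g \<in> carrier ?G" for g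
  proof -
    have "g \<in> block_group"
      using minimal[OF perm_subgroup_block_group K_subset_block_group t_mem_block_group] that by auto
    then obtain y k where g: "g = block_prod d y \<circ> (t ^^ k)" and y: "\<And>j. y j \<in> K"
      by (auto simp: block_group_def)
    have "g = block_prod d y \<circ> h (int (k mod d))"
      by (simp add: g h_def t_pow_mod)
    moreover have "int (k mod d) \<in> carrier ?H"
      using d_pos by (simp add: H_carrier)
    moreover obtain x where "x \<in> carrier ?N" "block_prod d y = f x"
      using lift[of y, OF y] by blast
    ultimately show ?thesis
      by (intro bexI[of _ x] bexI[of _ "int (k mod d)"]) simp_all
  qed
qed

end


section \<open>The exceptional action of \<open>S\<^sub>5\<close> on six points\<close>

locale six_points =
  fixes a b c d c' d' :: 'a
  assumes dist: "distinct [a, b, c, d, c', d']"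
begin

lemma dist_rev: "distinct [d', c', d, c, b, a]"
  using dist by auto

abbreviation points :: "'a set" where
  "points \<equiv> {a, b, c, d, c', d'}"

definition pairing :: "'a \<Rightarrow> 'a \<Rightarrow> 'a \<Rightarrow> 'a \<Rightarrow> 'a \<Rightarrow> 'a \<Rightarrow> 'a \<Rightarrow> 'a" where
  "pairing p q u v y z = transpose p q \<circ> transpose u v \<circ> transpose y z"

text \<open>The involutions are perfect matchings of the six points.  The five of them form a
  \<open>1\<close>-factorisation of the complete graph, found as the one preserved by the two \<open>4\<close>-cycles
  \<open>(a b c d)\<close> and \<open>(a b c' d')\<close>.\<close>

definition matching :: "nat \<Rightarrow> 'a \<Rightarrow> 'a" where
  "matching i =
    (if i = 1 then pairing c' d' a c b d
     else if i = 2 then pairing c d a c' b d'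
     else if i = 3 then pairing a d b c' c d'
     else if i = 4 then pairing a b c c' d d'
     else pairing b c d c' a d')"

lemma matching_simps [simp]:
  "matching (Suc 0) a = c" "matching (Suc 0) b = d" "matching (Suc 0) c = a"
  "matching (Suc 0) d = b" "matching (Suc 0) c' = d'" "matching (Suc 0) d' = c'"
  "matching 2 a = c'" "matching 2 b = d'" "matching 2 c = d"
  "matching 2 d = c" "matching 2 c' = a" "matching 2 d' = b"
  "matching 3 a = d" "matching 3 b = c'" "matching 3 c = d'"
  "matching 3 d = a" "matching 3 c' = b" "matching 3 d' = c"
  "matching 4 a = b" "matching 4 b = a" "matching 4 c = c'"
  "matching 4 d = d'" "matching 4 c' = c" "matching 4 d' = d"
  "matching 5 a = d'" "matching 5 b = c" "matching 5 c = b"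
  "matching 5 d = c'" "matching 5 c' = d" "matching 5 d' = a"
  using dist dist_rev by (simp_all add: matching_def pairing_def)

lemma matching_outside: "z \<notin> points \<Longrightarrow> matching i z = z"
  by (simp add: matching_def pairing_def)

lemma atLeastAtMost_1_5: "{1..5::nat} = {1, 2, 3, 4, 5}"
  by auto

lemma inj_on_matching: "inj_on matching {1..5}"
proof (rule inj_onI)
  fix i j :: nat assume ij: "i \<in> {1..5}" "j \<in> {1..5}" "matching i = matching j"
  then have "matching i a = matching j a" by simp
  with ij(1,2) show "i = j"
    using dist dist_rev unfolding atLeastAtMost_1_5 by (elim insertE) simp_all
qed

text \<open>The equation says, without inverses, that conjugation by \<open>p\<close> takes one
  factor to another. Inside the symmetric group on six points this is the transitive copy of
  \<open>S_5\<close>, that is, \<open>PGL(2,5)\<close>.\<close>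

definition stab :: "('a \<Rightarrow> 'a) set" where
  "stab = {p. p permutes points \<and> (\<forall>i\<in>{1..5}. \<exists>j\<in>{1..5}. p \<circ> matching i = matching j \<circ> p)}"

text \<open>The index is unique by injectivity of \<open>matching\<close>; other indices are fixed
  so that \<open>act p\<close> is a permutation of \<open>{1..5}\<close>.\<close>

definition act :: "('a \<Rightarrow> 'a) \<Rightarrow> nat \<Rightarrow> nat" where
  "act p i = (if i \<in> {1..5} then (SOME j. j \<in> {1..5} \<and> p \<circ> matching i = matching j \<circ> p) else i)"

lemma stab_permutes: "p \<in> stab \<Longrightarrow> p permutes points"
  by (simp add: stab_def)

lemma act:
  assumes "p \<in> stab" "i \<in> {1..5}"
  shows "act p i \<in> {1..5}" "p \<circ> matching i = matching (act p i) \<circ> p"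
proof -
  have "\<exists>j. j \<in> {1..5} \<and> p \<circ> matching i = matching j \<circ> p"
    using assms unfolding stab_def by blast
  from someI_ex[OF this] assms(2)
  show "act p i \<in> {1..5}" "p \<circ> matching i = matching (act p i) \<circ> p"
    unfolding act_def by presburger+
qed

lemma act_outside: "i \<notin> {1..5} \<Longrightarrow> act p i = i"
  by (simp only: act_def if_False)

lemma act_unique:
  assumes p: "p \<in> stab" and i: "i \<in> {1..5}" and j: "j \<in> {1..5}"
    and eq: "p \<circ> matching i = matching j \<circ> p"
  shows "act p i = j"
proof -
  have "matching (act p i) \<circ> p = matching j \<circ> p"
    using act(2)[OF p i] eq by simp
  then have "matching (act p i) \<circ> (p \<circ> inv' p) = matching j \<circ> (p \<circ> inv' p)"
    by (simp only: comp_assoc[symmetric])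
  then have "matching (act p i) = matching j"
    using permutes_inv_o(1)[OF stab_permutes[OF p]] by simp
  then show ?thesis
    using inj_on_matching act(1)[OF p i] j by (auto dest: inj_onD)
qed

lemma act_permutes:
  assumes p: "p \<in> stab"
  shows "act p permutes {1..5}"
proof (rule bij_imp_permutes)
  have inj: "inj_on (act p) {1..5}"
  proof (rule inj_onI)
    fix i j assume ij: "i \<in> {1..5}" "j \<in> {1..5}" "act p i = act p j"
    then have "p \<circ> matching i = p \<circ> matching j"
      using act(2)[OF p] by simp
    then have "(inv' p \<circ> p) \<circ> matching i = (inv' p \<circ> p) \<circ> matching j"
      by (simp only: comp_assoc)
    then have "matching i = matching j"
      using permutes_inv_o(2)[OF stab_permutes[OF p]] by simp
    then show "i = j"
      using inj_on_matching ij by (auto dest: inj_onD)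
  qed
  moreover have "act p ` {1..5} \<subseteq> {1..5}"
    using act(1)[OF p] by blast
  ultimately show "bij_betw (act p) {1..5} {1..5}"
    by (simp add: bij_betw_def endo_inj_surj)
qed (rule act_outside)

lemma id_stab: "id \<in> stab"
  by (auto simp: stab_def permutes_id)

lemma comp_stab_act:
  assumes p: "p \<in> stab" and q: "q \<in> stab"
  shows "p \<circ> q \<in> stab \<and> act (p \<circ> q) = act p \<circ> act q"
proof -
  have eq: "(p \<circ> q) \<circ> matching i = matching (act p (act q i)) \<circ> (p \<circ> q)" if "i \<in> {1..5}" for i
  proof -
    have "(p \<circ> q) \<circ> matching i = (p \<circ> matching (act q i)) \<circ> q"
      by (simp only: comp_assoc act(2)[OF q that])
    also have "\<dots> = matching (act p (act q i)) \<circ> (p \<circ> q)"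
      by (simp only: comp_assoc act(2)[OF p act(1)[OF q that]])
    finally show ?thesis .
  qed
  have pq: "p \<circ> q \<in> stab"
    using eq act(1)[OF p act(1)[OF q]] permutes_compose[OF stab_permutes[OF q] stab_permutes[OF p]]
    unfolding stab_def by blast
  moreover have "act (p \<circ> q) i = (act p \<circ> act q) i" for i
  proof (cases "i \<in> {1..5}")
    case True
    then show ?thesis
      using act(1)[OF p act(1)[OF q True]] by (auto intro!: act_unique[OF pq] eq)
  next
    case False
    then show ?thesis by (simp only: act_outside[OF False] comp_apply)
  qed
  ultimately show ?thesis by blast
qed

lemma inv_stab:
  assumes p: "p \<in> stab"
  shows "inv' p \<in> stab"
proof -
  have "\<exists>j\<in>{1..5}. inv' p \<circ> matching i = matching j \<circ> inv' p" if i: "i \<in> {1..5}" for i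
  proof -
    obtain j where j: "j \<in> {1..5}" "act p j = i"
      using i act_permutes[OF p] by (metis permutes_image imageE)
    have "inv' p \<circ> matching i = inv' p \<circ> (matching i \<circ> p) \<circ> inv' p"
      using permutes_inv_o(1)[OF stab_permutes[OF p]] by (simp add: comp_assoc)
    also have "\<dots> = (inv' p \<circ> p) \<circ> matching j \<circ> inv' p"
      using act(2)[OF p j(1)] by (simp add: j(2) comp_assoc)
    also have "\<dots> = matching j \<circ> inv' p"
      using permutes_inv_o(2)[OF stab_permutes[OF p]] by simp
    finally show ?thesis using j(1) by blast
  qed
  then show ?thesis
    using permutes_inv[OF stab_permutes[OF p]] by (auto simp: stab_def)
qed

lemma perm_subgroup_stab: "perm_subgroup stab"
  unfolding perm_subgroup_def
  using id_stab comp_stab_act inv_stab permutes_bij[OF stab_permutes] by blast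

text \<open>An element commuting with all five matchings is determined by the image of
  \<open>a\<close>, since the matchings pair \<open>a\<close> with each of the other points.\<close>

lemma act_id_imp_id:
  assumes p: "p \<in> stab" and id: "act p = id"
  shows "p = id"
proof -
  have comm: "p (matching i u) = matching i (p u)" if "i \<in> {1..5}" for i u
    using fun_cong[OF act(2)[OF p that], of u] by (simp only: comp_apply id id_apply)
  have step: "p c = matching 1 (p a)" "p c' = matching 2 (p a)" "p d = matching 3 (p a)"
    "p b = matching 4 (p a)" "p d' = matching 5 (p a)"
    using comm[of 1 a] comm[of 2 a] comm[of 3 a] comm[of 4 a] comm[of 5 a] by simp_all
  \<comment> \<open>The image of \<open>a\<close> inherits two relations valid at \<open>a\<close>:
    among the six points the first holds only at \<open>a\<close> and \<open>d'\<close>, and the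
    second fails at \<open>d'\<close>.\<close>
  have *: "matching 1 (p a) = matching 5 (matching 4 (p a))"
    using comm[of 5 b] step(1,4) by simp
  have **: "matching 1 (p a) = matching 2 (matching 3 (p a))"
    using comm[of 2 d] step(1,3) by simp
  have "p a \<in> points"
    using permutes_in_image[OF stab_permutes[OF p], of a] by simp
  then have "p a = a"
    using * ** dist dist_rev by (elim insertE) simp_all
  then have "p z = z" if "z \<in> points" for z
    using step that by (elim insertE) simp_all
  then have "p z = z" for z
    using permutes_not_in[OF stab_permutes[OF p]] by blast
  then show ?thesis by auto
qed

lemma act_hom: "act \<in> hom (perm_monoid stab) (sym_group 5)"
  using act_permutes comp_stab_act by (auto simp: hom_def sym_group_def)

lemma inj_on_act: "inj_on act stab"
proof -
  interpret group_hom "perm_monoid stab" "sym_group 5" act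
    by (intro group_hom.intro group_hom_axioms.intro group_perm_monoid perm_subgroup_stab
        sym_group_is_group act_hom)
  show ?thesis
    using inj_on_one_iff act_id_imp_id by (simp add: sym_group_one)
qed

lemma stabI:
  assumes "p permutes points"
    and "\<And>i. i \<in> {1..5} \<Longrightarrow> f i \<in> {1..5}"
    and "\<And>i u. i \<in> {1..5} \<Longrightarrow> u \<in> points \<Longrightarrow> p (matching i u) = matching (f i) (p u)"
  shows "p \<in> stab" and "\<And>i. i \<in> {1..5} \<Longrightarrow> act p i = f i"
proof -
  have eq: "p \<circ> matching i = matching (f i) \<circ> p" if "i \<in> {1..5}" for i
  proof
    fix u
    show "(p \<circ> matching i) u = (matching (f i) \<circ> p) u"
      using assms(1,3) that by (cases "u \<in> points") (simp_all add: matching_outside permutes_not_in)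
  qed
  then show p: "p \<in> stab"
    using assms(1,2) unfolding stab_def by blast
  show "act p i = f i" if "i \<in> {1..5}" for i
    using act_unique[OF p that assms(2)[OF that] eq[OF that]] .
qed

lemma stab_cycle1:
  "four_cycle a b c d \<in> stab" "act (four_cycle a b c d) = four_cycle 2 3 4 5"
proof -
  let ?x = "four_cycle a b c d" and ?f = "four_cycle 2 3 4 (5::nat)"
  have x: "?x a = b" "?x b = c" "?x c = d" "?x d = a" "?x c' = c'" "?x d' = d'"
    using dist dist_rev by (simp_all add: four_cycle_apply)
  have f: "?f (Suc 0) = Suc 0" "?f 2 = 3" "?f 3 = 4" "?f 4 = 5" "?f 5 = 2"
    by (simp_all add: four_cycle_apply)
  have perm: "?x permutes points"
    by (rule four_cycle_permutes) auto
  have comm: "?x (matching i u) = matching (?f i) (?x u)" if "i \<in> {1..5}" "u \<in> points" for i u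
    using that unfolding atLeastAtMost_1_5 by (elim insertE) (simp_all add: x f)
  have mem: "?f i \<in> {1..5}" if "i \<in> {1..5}" for i
    using that unfolding atLeastAtMost_1_5 by (elim insertE) (simp_all add: f)
  show "?x \<in> stab"
    by (rule stabI[OF perm mem comm])
  show "act ?x = ?f"
  proof
    fix i show "act ?x i = ?f i"
    proof (cases "i \<in> {1..5}")
      case True
      show ?thesis by (rule stabI(2)[OF perm mem comm True])
    next
      case False
      have "?f permutes {1..5}" by (rule four_cycle_permutes) auto
      then show ?thesis
        using act_outside[OF False] permutes_not_in[OF _ False] by metis
    qed
  qed
qed

lemma stab_cycle2:
  "four_cycle a b c' d' \<in> stab" "act (four_cycle a b c' d') = four_cycle (Suc 0) 5 4 3"
proof -
  let ?x = "four_cycle a b c' d'" and ?f = "four_cycle (Suc 0) 5 4 3"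
  have x: "?x a = b" "?x b = c'" "?x c = c" "?x d = d" "?x c' = d'" "?x d' = a"
    using dist dist_rev by (simp_all add: four_cycle_apply)
  have f: "?f (Suc 0) = 5" "?f 2 = 2" "?f 3 = Suc 0" "?f 4 = 3" "?f 5 = 4"
    by (simp_all add: four_cycle_apply)
  have perm: "?x permutes points"
    by (rule four_cycle_permutes) auto
  have comm: "?x (matching i u) = matching (?f i) (?x u)" if "i \<in> {1..5}" "u \<in> points" for i u
    using that unfolding atLeastAtMost_1_5 by (elim insertE) (simp_all add: x f)
  have mem: "?f i \<in> {1..5}" if "i \<in> {1..5}" for i
    using that unfolding atLeastAtMost_1_5 by (elim insertE) (simp_all add: f)
  show "?x \<in> stab"
    by (rule stabI[OF perm mem comm])
  show "act ?x = ?f"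
  proof
    fix i show "act ?x i = ?f i"
    proof (cases "i \<in> {1..5}")
      case True
      show ?thesis by (rule stabI(2)[OF perm mem comm True])
    next
      case False
      have "?f permutes {1..5}" by (rule four_cycle_permutes) auto
      then show ?thesis
        using act_outside[OF False] permutes_not_in[OF _ False] by metis
    qed
  qed
qed

text \<open>Intended for \<open>\<rho>\<close> in the case \<open>s = 2 * r\<close>, where it
  exchanges the two block points on each long strand. On the factors it acts as
  \<open>(1 2)(3 5)\<close>.\<close>

lemma stab_swap:
  assumes perm: "p permutes points"
    and p: "p a = a" "p b = b" "p c = c'" "p d = d'" "p c' = c" "p d' = d"
  shows "p \<in> stab"
proof (rule stabI[OF perm])
  let ?f = "\<lambda>i::nat. if i = Suc 0 then 2 else if i = 2 then Suc 0
    else if i = 3 then 5 else if i = 4 then 4 else 3"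
  show "p (matching i u) = matching (?f i) (p u)" if "i \<in> {1..5}" "u \<in> points" for i u
    using that unfolding atLeastAtMost_1_5 by (elim insertE) (simp_all add: p)
  show "?f i \<in> {1..5}" if "i \<in> {1..5}" for i
    using that unfolding atLeastAtMost_1_5 by (elim insertE) simp_all
qed

text \<open>The two 4-cycles are the images under \<open>act\<close> of
  \<open>four_cycle a b c d\<close> and of the inverse of
  \<open>four_cycle a b c' d'\<close>.\<close>

lemma transpose_1_2_word:
  "four_cycle 2 3 4 5 \<circ> (four_cycle 3 4 5 1 \<circ> (four_cycle 2 3 4 5 \<circ> (four_cycle 3 4 5 1 \<circ>
    four_cycle 2 3 4 5))) = transpose (1::nat) 2"
proof
  fix u :: nat
  show "(four_cycle 2 3 4 5 \<circ> (four_cycle 3 4 5 1 \<circ> (four_cycle 2 3 4 5 \<circ> (four_cycle 3 4 5 1 \<circ>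
    four_cycle 2 3 4 5)))) u = transpose (1::nat) 2 u"
  proof (cases "u \<in> {1, 2, 3, 4, 5}")
    case True
    then show ?thesis by (elim insertE) (simp_all add: four_cycle_apply)
  next
    case False
    then show ?thesis by (simp add: four_cycle_apply)
  qed
qed

text \<open>With \<open>S\<close> arbitrary the statement serves twice: for \<open>S = stab\<close>
  it makes \<open>act\<close> surjective, and together with injectivity of \<open>act\<close> it
  shows that the two 4-cycles generate \<open>stab\<close>.\<close>

lemma act_image_stab:
  assumes S: "perm_subgroup S" "four_cycle a b c d \<in> S" "four_cycle a b c' d' \<in> S"
  shows "{p. p permutes {1..5}} \<subseteq> act ` (stab \<inter> S)"
proof -
  let ?U = "act ` (stab \<inter> S)"
  have U: "perm_subgroup ?U"
    unfolding perm_subgroup_def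
  proof (intro conjI ballI)
    have act_id: "act id = id"
    proof
      fix i show "act id i = id i"
      proof (cases "i \<in> {1..5}")
        case True
        then show ?thesis
          using act_unique[OF id_stab True True] by simp
      next
        case False
        then show ?thesis
          using act_outside[OF False] by simp
      qed
    qed
    show "id \<in> ?U"
      using act_id id_stab perm_subgroup_id[OF S(1)] by (metis IntI image_eqI)
    fix f assume "f \<in> ?U"
    then obtain p where p: "f = act p" "p \<in> stab" "p \<in> S" by blast
    show "f \<circ> g \<in> ?U" if "g \<in> ?U" for g
    proof -
      obtain q where q: "g = act q" "q \<in> stab" "q \<in> S" using \<open>g \<in> ?U\<close> by blast
      show ?thesis
        using comp_stab_act[OF p(2) q(2)] perm_subgroup_comp[OF S(1) p(3) q(3)] p(1) q(1)
        by (metis IntI image_eqI)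
    qed
    show "bij f"
      using p act_permutes permutes_bij by blast
    have "act (inv' p) \<circ> act p = id" "act p \<circ> act (inv' p) = id"
      using comp_stab_act[OF inv_stab[OF p(2)] p(2)] comp_stab_act[OF p(2) inv_stab[OF p(2)]]
        permutes_inv_o[OF stab_permutes[OF p(2)]] act_id by simp_all
    then have "inv' f = act (inv' p)"
      unfolding p by (intro inv_unique_comp)
    then show "inv' f \<in> ?U"
      using inv_stab[OF p(2)] perm_subgroup_inv[OF S(1) p(3)] by auto
  qed
  have x: "four_cycle 2 3 4 5 \<in> ?U" and y: "four_cycle (Suc 0) 5 4 3 \<in> ?U"
    using S stab_cycle1 stab_cycle2 by (metis IntI image_eqI)+
  have y': "four_cycle 3 4 5 1 \<in> ?U"
    using perm_subgroup_inv[OF U y] by (simp add: inv_four_cycle)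
  have 2: "transpose 1 2 \<in> ?U"
    unfolding transpose_1_2_word[symmetric] by (intro perm_subgroup_comp[OF U] x y')
  \<comment> \<open>The 4-cycle fixes \<open>1\<close>, so repeated conjugation turns
    \<open>(1 2)\<close> into the star of all transpositions at \<open>1\<close>.\<close>
  have step: "transpose 1 (four_cycle 2 3 4 5 i) \<in> ?U" if "transpose 1 i \<in> ?U" for i
    using conj_mem_perm_subgroup[OF U x that]
    by (simp add: conj_transpose bij_four_cycle four_cycle_apply)
  have 3: "transpose 1 3 \<in> ?U" and 4: "transpose 1 4 \<in> ?U" and 5: "transpose 1 5 \<in> ?U"
  proof -
    show 3: "transpose 1 3 \<in> ?U" using step[OF 2] by (simp add: four_cycle_apply)
    show 4: "transpose 1 4 \<in> ?U" using step[OF 3] by (simp add: four_cycle_apply)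
    show 5: "transpose 1 5 \<in> ?U" using step[OF 4] by (simp add: four_cycle_apply)
  qed
  show ?thesis
  proof (rule permutes_subset_perm_subgroup[OF U])
    show "transpose 1 i \<in> ?U" if "i \<in> {1..5}" for i
      using that 2 3 4 5 perm_subgroup_id[OF U] unfolding atLeastAtMost_1_5
      by (elim insertE) auto
  qed simp
qed

lemma stab_subset:
  assumes "perm_subgroup S" "four_cycle a b c d \<in> S" "four_cycle a b c' d' \<in> S"
  shows "stab \<subseteq> S"
proof
  fix p assume p: "p \<in> stab"
  then have "act p \<in> act ` (stab \<inter> S)"
    using act_image_stab[OF assms] act_permutes by blast
  then show "p \<in> S"
    using inj_on_act p by (auto dest: inj_onD)
qed

lemma act_iso: "act \<in> iso (perm_monoid stab) (sym_group 5)"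
proof -
  have "act ` stab = carrier (sym_group 5)"
    using act_image_stab[OF perm_subgroup_stab stab_cycle1(1) stab_cycle2(1)] act_permutes
    by (auto simp: sym_group_carrier)
  then show ?thesis
    using act_hom inj_on_act by (simp add: iso_def bij_betw_def)
qed

end


section \<open>Four rotated strands\<close>

lemma gcd_chinese_remainder_nat:
  fixes r s i j :: nat
  assumes "0 < r" "0 < s" and cong: "i mod gcd r s = j mod gcd r s"
  obtains m where "m mod r = i mod r" "m mod s = j mod s"
proof -
  let ?d = "gcd r s"
  obtain x y where xy: "r * x = s * y + ?d"
    using bezout_nat[of r s] assms(1) by auto
  \<comment> \<open>Adding a multiple of \<open>s\<close> changes \<open>j\<close> neither modulo
    \<open>s\<close> nor modulo the gcd, and makes the difference \<open>j' - i\<close>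
    nonnegative.\<close>
  define j' where "j' = j + s * i"
  have le: "i \<le> j'"
    using \<open>0 < s\<close> by (simp add: j'_def trans_le_add2)
  have "j' mod ?d = i mod ?d"
    using cong by (simp add: j'_def mod_add_right_eq[symmetric] mod_mult_left_eq[symmetric])
  then have "?d dvd j' - i"
    using le by (simp add: mod_eq_dvd_iff_nat)
  then obtain u where u: "j' = i + ?d * u"
    using le by (metis dvd_def le_add_diff_inverse)
  \<comment> \<open>By the Bezout identity, \<open>m\<close> exceeds \<open>j'\<close> by the
    multiple \<open>s * (y * u)\<close> of \<open>s\<close>.\<close>
  define m where "m = i + r * (x * u)"
  have "m = i + (s * y + ?d) * u"
    by (simp add: m_def xy[symmetric] mult.assoc)
  then have "m = j + s * (i + y * u)"
    using u by (simp add: j'_def algebra_simps)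
  then have "m mod s = j mod s" by simp
  moreover have "m mod r = i mod r" by (simp add: m_def)
  ultimately show thesis by (intro that)
qed

text \<open>\<open>pt k i\<close> is the label of the \<open>i\<close>-th edge, counted cyclically, around the \<open>k\<close>-th black vertex.\<close>

locale four_strands =
  fixes r s n :: nat and s0 s1 :: "nat \<Rightarrow> nat" and pt :: "nat \<Rightarrow> nat \<Rightarrow> nat"
    and len :: "nat \<Rightarrow> nat" and d :: nat
  assumes r_pos: "0 < r" and r_less_s: "r < s" and n: "n = 2 * r + 2 * s"
    and len_def: "\<And>k. len k = (if k < 2 then r else s)"
    and d_def: "d = gcd r s"
    and s0_permutes: "s0 permutes {1..n}"
    and points_eq: "{1..n} = {pt k i | k i. k < 4}"
    and s0_pt: "\<And>k i. k < 4 \<Longrightarrow> s0 (pt k i) = pt k (Suc i)"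
    and pt_eq_iff: "\<And>k i l j. k < 4 \<Longrightarrow> l < 4 \<Longrightarrow>
      pt k i = pt l j \<longleftrightarrow> k = l \<and> i mod len k = j mod len k"
    and s1_eq: "s1 = four_cycle (pt 0 0) (pt 1 0) (pt 2 0) (pt 3 0)"
begin

lemma d_pos: "0 < d"
  using r_pos by (simp add: d_def)

lemma d_dvd_len: "d dvd len k"
  by (simp add: len_def d_def)

lemma len_pos: "0 < len k"
  using r_pos r_less_s by (simp add: len_def)

lemma s0_pow_pt: "k < 4 \<Longrightarrow> (s0 ^^ m) (pt k i) = pt k (i + m)"
  by (induction m) (simp_all add: s0_pt)

lemma pt_mem: "k < 4 \<Longrightarrow> pt k i \<in> {1..n}"
  unfolding points_eq by blast

lemma s1_permutes: "s1 permutes {1..n}"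
  unfolding s1_eq four_cycle_def by (intro permutes_compose permutes_swap_id pt_mem) simp_all

definition G :: "(nat \<Rightarrow> nat) set" where
  "G = generate (sym_group n) {s0, s1}"

lemma gens_subset: "{s0, s1} \<subseteq> carrier (sym_group n)"
  using s0_permutes s1_permutes by (simp add: sym_group_carrier)

lemma perm_subgroup_G: "perm_subgroup G"
  unfolding G_def by (rule perm_subgroup_generate_sym_group[OF gens_subset])

lemma s0_mem_G: "s0 \<in> G" and s1_mem_G: "s1 \<in> G"
  unfolding G_def by (simp_all add: generate.incl)

lemma G_minimal: "perm_subgroup U \<Longrightarrow> s0 \<in> U \<Longrightarrow> s1 \<in> U \<Longrightarrow> G \<subseteq> U"
  unfolding G_def by (rule generate_sym_group_minimal[OF gens_subset]) simp_all

text \<open>The Chinese remainder theorem gives a power of \<open>s0\<close> that moves the first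
  edges of the short strands to index \<open>i\<close> and those of the long ones to index
  \<open>j\<close>; it conjugates \<open>s1\<close> as required.\<close>

lemma four_cycle_mem_G:
  assumes "i mod d = j mod d"
  shows "four_cycle (pt 0 i) (pt 1 i) (pt 2 j) (pt 3 j) \<in> G"
proof -
  obtain m where m: "m mod r = i mod r" "m mod s = j mod s"
    using gcd_chinese_remainder_nat[of r s i j] r_pos r_less_s assms unfolding d_def by auto
  have eq: "(s0 ^^ m) (pt 0 0) = pt 0 i" "(s0 ^^ m) (pt 1 0) = pt 1 i"
    "(s0 ^^ m) (pt 2 0) = pt 2 j" "(s0 ^^ m) (pt 3 0) = pt 3 j"
    using m by (simp_all add: s0_pow_pt pt_eq_iff len_def)
  have pow: "s0 ^^ m \<in> G"
    by (intro perm_subgroup_funpow perm_subgroup_G s0_mem_G)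
  have "s0 ^^ m \<circ> s1 \<circ> inv' (s0 ^^ m) \<in> G"
    by (intro conj_mem_perm_subgroup perm_subgroup_G pow s1_mem_G)
  then show ?thesis
    unfolding s1_eq by (simp only: conj_four_cycle[OF perm_subgroup_bij[OF perm_subgroup_G pow]] eq)
qed

definition B :: "nat set" where
  "B = {pt k i | k i. k < 4 \<and> d dvd i}"

text \<open>An index matters only modulo \<open>len k\<close>; divisibility by \<open>d\<close> is
  well defined because \<open>d\<close> divides \<open>len k\<close>.\<close>

lemma pt_mem_B_iff: "k < 4 \<Longrightarrow> pt k i \<in> B \<longleftrightarrow> d dvd i"
proof
  assume k: "k < 4" and "pt k i \<in> B"
  then obtain j where j: "d dvd j" "i mod len k = j mod len k"
    by (auto simp: B_def pt_eq_iff)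
  then show "d dvd i"
    using d_dvd_len[of k] by (metis dvd_mod_iff)
qed (auto simp: B_def)

lemma B_subset: "B \<subseteq> {1..n}"
  unfolding B_def points_eq by blast

definition \<rho> :: "nat \<Rightarrow> nat" where
  "\<rho> z = (if z \<in> B then (s0 ^^ d) z else z)"

lemma \<rho>_pt: "k < 4 \<Longrightarrow> \<rho> (pt k i) = (if d dvd i then pt k (i + d) else pt k i)"
  by (simp add: \<rho>_def pt_mem_B_iff s0_pow_pt)

lemma \<rho>_permutes: "\<rho> permutes B"
proof (rule bij_imp_permutes)
  have "inj_on \<rho> B"
    using permutes_inj[OF permutes_funpow[OF s0_permutes, of d]]
    by (auto simp: \<rho>_def inj_on_def)
  moreover have "\<rho> ` B \<subseteq> B"
    by (auto simp: B_def \<rho>_pt) (metis dvd_add dvd_refl)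
  moreover have "finite B"
    using B_subset by (rule finite_subset) simp
  ultimately show "bij_betw \<rho> B B"
    by (simp add: bij_betw_def endo_inj_surj)
qed (simp add: \<rho>_def)

text \<open>Dividing \<open>s0\<close> by its \<open>d\<close>-th power on the single block \<open>B\<close> makes it an element of order
  \<open>d\<close> that still permutes the blocks cyclically; it generates the complement \<open>\<int>\<^sub>d\<close>.\<close>

definition t :: "nat \<Rightarrow> nat" where
  "t = s0 \<circ> inv' \<rho>"

lemma s0_eq: "s0 = t \<circ> \<rho>"
  using permutes_inv_o(2)[OF \<rho>_permutes] by (simp add: t_def comp_assoc)

text \<open>On the block \<open>\<rho>\<close> advances by \<open>d\<close>, so \<open>t\<close>
  undoes this before it advances by one. The argument is written with \<open>i + d\<close> to avoid
  subtraction.\<close>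

lemma t_pt:
  assumes "k < 4"
  shows "d dvd i \<Longrightarrow> t (pt k (i + d)) = pt k (Suc i)"
    and "\<not> d dvd i \<Longrightarrow> t (pt k i) = pt k (Suc i)"
  using fun_cong[OF s0_eq, of "pt k i"] assms by (simp_all add: s0_pt \<rho>_pt)

text \<open>The first step falls back by \<open>d\<close> and advances by one; the indices met next
  are not divisible by \<open>d\<close>, so the following steps are plain steps of
  \<open>s0\<close>, and the starting point is reached again at \<open>j = d\<close>.\<close>

lemma t_pow_pt:
  assumes "k < 4" "d dvd i" "0 < j" "j \<le> d"
  shows "(t ^^ j) (pt k (i + d)) = pt k (i + j)"
  using assms(3,4)
proof (induction j)
  case (Suc j)
  show ?case
  proof (cases "j = 0")
    case True
    then show ?thesis using assms by (simp add: t_pt)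
  next
    case False
    then have "\<not> d dvd i + j"
      using assms(2) Suc.prems by (auto simp: dvd_add_right_iff dest: dvd_imp_le)
    with False Suc assms(1) show ?thesis by (simp add: t_pt)
  qed
qed simp

lemma B_cases:
  assumes "b \<in> B"
  obtains k i where "k < 4" "d dvd i" "b = pt k (i + d)"
proof -
  obtain k i where ki: "k < 4" "d dvd i" "b = pt k i"
    using assms by (auto simp: B_def)
  have "d \<le> len k"
    using d_dvd_len len_pos by (rule dvd_imp_le)
  \<comment> \<open>Adding a full turn \<open>len k\<close> before removing \<open>d\<close> keeps
    the index natural.\<close>
  then have "b = pt k ((i + (len k - d)) + d)"
    using ki by (simp add: pt_eq_iff)
  moreover have "d dvd i + (len k - d)"
    using ki d_dvd_len by (simp add: dvd_diff_nat)
  ultimately show thesis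
    using that ki by blast
qed

lemma t_permutes: "t permutes {1..n}"
  unfolding t_def using s0_permutes permutes_subset[OF permutes_inv[OF \<rho>_permutes] B_subset]
  by (intro permutes_compose)

lemma t_pow_d: "t ^^ d = id"
proof
  fix z
  have base: "(t ^^ d) b = b" if "b \<in> B" for b
    using that by (rule B_cases) (simp add: t_pow_pt d_pos)
  show "(t ^^ d) z = id z"
  proof (cases "z \<in> {1..n}")
    case True
    then obtain k i where ki: "k < 4" "z = pt k i"
      unfolding points_eq by blast
    show ?thesis
    proof (cases "d dvd i")
      case True
      then show ?thesis using base[of z] ki by (simp add: pt_mem_B_iff)
    next
      case False
      \<comment> \<open>\<open>?b\<close> is the block point from which \<open>i mod d\<close> steps
        of \<open>t\<close> lead to \<open>z\<close>; its period carries over because powers of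
        \<open>t\<close> commute.\<close>
      let ?b = "pt k (d * (i div d) + d)"
      have "0 < i mod d"
        using False by (simp add: dvd_eq_mod_eq_0)
      then have "z = (t ^^ (i mod d)) ?b"
        using ki d_pos by (simp add: t_pow_pt less_imp_le)
      then have "(t ^^ d) z = (t ^^ (i mod d)) ((t ^^ d) ?b)"
        by (metis add.commute comp_apply funpow_add)
      also have "(t ^^ d) ?b = ?b"
        by (rule base) (simp add: pt_mem_B_iff ki)
      finally show ?thesis
        using \<open>z = (t ^^ (i mod d)) ?b\<close> by simp
    qed
  next
    case False
    then show ?thesis
      using permutes_not_in[OF permutes_funpow[OF t_permutes]] by simp
  qed
qed

lemma rotated_blocks:
  assumes "perm_subgroup K" "\<And>f. f \<in> K \<Longrightarrow> f permutes B"
  shows "rotated_blocks t d B K"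
proof
  show "B \<noteq> {}"
    using pt_mem_B_iff[of 0 0] by auto
  show "(t ^^ j) ` B \<inter> B = {}" if j: "0 < j" "j < d" for j
  proof -
    have "(t ^^ j) b \<notin> B" if b: "b \<in> B" for b
      using b
    proof (rule B_cases)
      fix k i assume ki: "k < 4" "d dvd i" "b = pt k (i + d)"
      have "\<not> d dvd i + j"
        using ki(2) j by (auto simp: dvd_add_right_iff dest: dvd_imp_le)
      then show "(t ^^ j) b \<notin> B"
        using ki j by (simp add: t_pow_pt pt_mem_B_iff)
    qed
    then show ?thesis by blast
  qed
qed (use assms d_pos t_pow_d permutes_bij[OF t_permutes] in auto)

lemma t_mem_G:
  assumes "K \<subseteq> G" "\<rho> \<in> K"
  shows "t \<in> G"
  unfolding t_def using assms
  by (intro perm_subgroup_comp perm_subgroup_inv perm_subgroup_G s0_mem_G) auto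

text \<open>Since \<open>s0 = t \<circ> \<rho>\<close> with \<open>\<rho>\<close> in
  \<open>K\<close>, generating by \<open>s0\<close> and \<open>s1\<close> amounts to generating by
  \<open>t\<close> and \<open>K\<close>.\<close>

lemma iso_some_semidirect_G:
  assumes K: "perm_subgroup K" "\<And>f. f \<in> K \<Longrightarrow> f permutes B" "K \<subseteq> G" "\<rho> \<in> K" "s1 \<in> K"
    and Q: "group Q" "\<iota> \<in> iso Q (perm_monoid K)"
  shows "iso_some_semidirect_product (perm_monoid G) (group_power Q d) (integer_mod_group d)"
proof -
  interpret rb: rotated_blocks t d B K
    by (rule rotated_blocks[OF K(1,2)])
  have "t \<in> G"
    using K(3,4) by (rule t_mem_G)
  moreover have "G \<subseteq> U" if U: "perm_subgroup U" "K \<subseteq> U" "t \<in> U" for U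
  proof (rule G_minimal[OF U(1)])
    show "s0 \<in> U"
      using perm_subgroup_comp[OF U(1) U(3) subsetD[OF U(2) K(4)]] s0_eq by simp
    show "s1 \<in> U" using U K by blast
  qed
  ultimately show ?thesis
    by (rule rb.iso_some_semidirect_block_group[OF perm_subgroup_G K(3) _ _ Q])
qed

text \<open>For \<open>d = 1\<close> the period of \<open>t\<close> forces \<open>t = id\<close>, so
  both generators lie in \<open>K\<close>.\<close>

lemma G_eq_if_coprime:
  assumes K: "perm_subgroup K" "K \<subseteq> G" "\<rho> \<in> K" "s1 \<in> K" and "d = 1"
  shows "G = K"
proof
  have "t = id"
    using t_pow_d \<open>d = 1\<close> by simp
  then have "s0 = \<rho>"
    using s0_eq by simp
  with K show "G \<subseteq> K"
    by (intro G_minimal) simp_all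
qed (fact K(2))

lemma s1_permutes_B: "s1 permutes B"
  unfolding s1_eq four_cycle_def
  by (intro permutes_compose permutes_swap_id) (simp_all add: pt_mem_B_iff)

lemma card_B: "card B = n div d"
proof -
  let ?I = "SIGMA k:{..<4}. {..<len k div d}"
  let ?f = "\<lambda>(k, q). pt k (d * q)"
  have "bij_betw ?f ?I B"
    unfolding bij_betw_def
  proof
    have lt: "d * q < len k" if "q < len k div d" for k q
      using that d_pos by (metis d_dvd_len dvd_mult_div_cancel mult_less_mono2)
    show "inj_on ?f ?I"
      using d_pos by (auto simp: inj_on_def pt_eq_iff lt)
    show "?f ` ?I = B"
    proof
      show "?f ` ?I \<subseteq> B" by (auto simp: pt_mem_B_iff)
      show "B \<subseteq> ?f ` ?I"
      proof
        fix b assume "b \<in> B"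
        then obtain k i where ki: "k < 4" "d dvd i" "b = pt k i" by (auto simp: B_def)
        have "d dvd i mod len k"
          using ki d_dvd_len by (simp add: dvd_mod)
        then obtain q where q: "i mod len k = d * q" by blast
        then have "d * q < d * (len k div d)"
          using len_pos d_dvd_len by (metis dvd_mult_div_cancel mod_less_divisor)
        then have "(k, q) \<in> ?I" using ki by simp
        moreover have "b = pt k (d * q)"
          using ki q by (simp add: pt_eq_iff flip: q)
        ultimately show "b \<in> ?f ` ?I" by force
      qed
    qed
  qed
  then have "card B = card ?I"
    by (rule bij_betw_same_card[symmetric])
  also have "\<dots> = (\<Sum>k<4. len k div d)" by simp
  also have "\<dots> = 2 * (r div d) + 2 * (s div d)"
    by (simp add: numeral_eq_Suc len_def)
  also have "\<dots> = n div d"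
  proof -
    obtain r' s' where "r = d * r'" "s = d * s'"
      unfolding d_def by (meson dvd_def gcd_dvd1 gcd_dvd2)
    then have "n = d * (2 * r' + 2 * s')" by (simp add: n algebra_simps)
    then show ?thesis
      using \<open>r = d * r'\<close> \<open>s = d * s'\<close> d_pos by simp
  qed
  finally show ?thesis .
qed

text \<open>After division by \<open>d\<close>, the value \<open>s' = 2\<close> would force
  \<open>r' = 1\<close> and hence \<open>s = 2 * r\<close>. The bound gives each long strand at
  least three points in the block.\<close>

lemma three_d_le_s:
  assumes "s \<noteq> 2 * r"
  shows "3 * d \<le> s"
proof -
  obtain r' s' where rs: "r = d * r'" "s = d * s'"
    unfolding d_def by (meson dvd_def gcd_dvd1 gcd_dvd2)
  have "0 < r'" "r' < s'"
    using r_pos r_less_s rs by auto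
  moreover have "s' \<noteq> 2 * r'"
    using assms rs by auto
  ultimately have "3 \<le> s'" by linarith
  then show ?thesis
    using rs by simp
qed

lemma permutes_B_subset_G:
  assumes "s \<noteq> 2 * r"
  shows "{p. p permutes B} \<subseteq> G"
proof -
  \<comment> \<open>Three 4-cycles through \<open>pt 0 0\<close> and \<open>pt 1 0\<close> are used,
    at the long indices \<open>j\<close>, \<open>j + d\<close> and \<open>j + 2 * d\<close>; the
    bound \<open>3 * d \<le> s\<close> keeps these distinct modulo \<open>s\<close>.\<close>
  have cd: "transpose (pt 2 j) (pt 3 j) \<in> G" if j: "d dvd j" for j
  proof (rule transpose_from_three_four_cycles[OF perm_subgroup_G])
    have *: "(u + v) mod s \<noteq> u mod s" if "0 < v" "v < s" for u v
    proof
      assume "(u + v) mod s = u mod s"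
      then have "s dvd v"
        using mod_eq_dvd_iff_nat[of u "u + v" s] by simp
      with that show False by (auto dest: dvd_imp_le)
    qed
    have "d < s" "2 * d < s"
      using three_d_le_s[OF assms] d_pos by linarith+
    then have ne: "(j + d) mod s \<noteq> j mod s" "(j + 2 * d) mod s \<noteq> j mod s"
      "(j + 2 * d) mod s \<noteq> (j + d) mod s"
      using d_pos *[of d j] *[of "2 * d" j] *[of d "j + d"] by (simp_all add: mult_2 add.assoc)
    have len: "len 0 = r" "len 1 = r" "len 2 = s" "len 3 = s"
      by (simp_all add: len_def)
    show "distinct [pt 0 0, pt 1 0, pt 2 j, pt 3 j, pt 2 (j + d), pt 3 (j + d),
        pt 2 (j + 2 * d), pt 3 (j + 2 * d)]"
      using ne ne[symmetric] by (simp add: pt_eq_iff len)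
    have "d dvd j + d" "d dvd j + 2 * d"
      using j by simp_all
    then show "four_cycle (pt 0 0) (pt 1 0) (pt 2 j) (pt 3 j) \<in> G"
      "four_cycle (pt 0 0) (pt 1 0) (pt 2 (j + d)) (pt 3 (j + d)) \<in> G"
      "four_cycle (pt 0 0) (pt 1 0) (pt 2 (j + 2 * d)) (pt 3 (j + 2 * d)) \<in> G"
      using j by (intro four_cycle_mem_G; simp add: dvd_eq_mod_eq_0)+
  qed
  have conn: "transpose (pt 0 i) (pt 1 i) \<in> G" "transpose (pt 0 i) (pt 2 j) \<in> G"
      "transpose (pt 0 i) (pt 3 j) \<in> G"
    if ij: "d dvd i" "d dvd j" for i j
  proof -
    have dist: "distinct [pt 0 i, pt 1 i, pt 2 j, pt 3 j]"
      by (simp add: pt_eq_iff)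
    have mem: "four_cycle (pt 0 i) (pt 1 i) (pt 2 j) (pt 3 j) \<in> G"
      using ij by (intro four_cycle_mem_G) (simp add: dvd_eq_mod_eq_0)
    show "transpose (pt 0 i) (pt 1 i) \<in> G" "transpose (pt 0 i) (pt 2 j) \<in> G"
      "transpose (pt 0 i) (pt 3 j) \<in> G"
      using transpose_from_four_cycle[OF perm_subgroup_G dist mem cd[OF ij(2)]] by simp_all
  qed
  show ?thesis
  proof (rule permutes_subset_perm_subgroup[OF perm_subgroup_G])
    show "finite B"
      using B_subset by (rule finite_subset) simp
    fix b assume "b \<in> B"
    then obtain k i where ki: "k < 4" "d dvd i" "b = pt k i" by (auto simp: B_def)
    \<comment> \<open>Two points of the same short strand are linked through
      \<open>pt 2 0\<close>.\<close>
    have a: "transpose (pt 0 0) (pt 0 i) \<in> G"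
    proof (rule transpose_mem_trans[OF perm_subgroup_G])
      show "transpose (pt 0 0) (pt 2 0) \<in> G"
        by (rule conn(2)) simp_all
      show "transpose (pt 2 0) (pt 0 i) \<in> G"
        unfolding transpose_commute[of "pt 2 0"] using ki(2) by (intro conn(2)) simp_all
    qed
    then have "transpose (pt 0 0) (pt 1 i) \<in> G"
      using ki(2) by (rule transpose_mem_trans[OF perm_subgroup_G _ conn(1)[OF _ dvd_0_right]])
    moreover have "transpose (pt 0 0) (pt 2 i) \<in> G" "transpose (pt 0 0) (pt 3 i) \<in> G"
      using ki(2) by (auto intro: conn(2,3))
    moreover have "k = 0 \<or> k = 1 \<or> k = 2 \<or> k = 3"
      using ki(1) by linarith
    ultimately show "transpose (pt 0 0) b \<in> G"
      using a ki(3) by blast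
  qed
qed

lemma generic_case:
  assumes "s \<noteq> 2 * r"
  shows "iso_some_semidirect_product (perm_monoid G) (group_power (sym_group (n div d)) d)
      (integer_mod_group d)"
    and "d = 1 \<Longrightarrow> perm_monoid G = sym_group n"
proof -
  let ?K = "{p. p permutes B}"
  have K: "perm_subgroup ?K" "?K \<subseteq> G" "\<rho> \<in> ?K" "s1 \<in> ?K"
    using permutes_B_subset_G[OF assms] perm_subgroup_permutes \<rho>_permutes s1_permutes_B by auto
  have "finite B"
    using B_subset by (rule finite_subset) simp
  then obtain f where "bij_betw f {1..n div d} B"
    using card_B by (metis card_atLeastAtMost diff_Suc_1 finite_atLeastAtMost finite_same_card_bij)
  then have "map_permutation {1..n div d} f \<in> iso (sym_group (n div d)) (perm_monoid ?K)"
    unfolding sym_group_eq_perm_monoid by (rule iso_perm_monoid_permutes)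
  then show "iso_some_semidirect_product (perm_monoid G) (group_power (sym_group (n div d)) d)
      (integer_mod_group d)"
    by (intro iso_some_semidirect_G[OF K(1) _ K(2-4) sym_group_is_group]) simp_all
  show "perm_monoid G = sym_group n" if "d = 1"
  proof -
    have "B = {1..n}"
      using that unfolding B_def points_eq by simp
    then show ?thesis
      using G_eq_if_coprime[OF K that] by (simp add: sym_group_eq_perm_monoid)
  qed
qed

lemma exceptional_case:
  assumes s: "s = 2 * r"
  shows "iso_some_semidirect_product (perm_monoid G) (group_power (sym_group (n div d - 1)) d)
      (integer_mod_group d)"
    and "d = 1 \<Longrightarrow> perm_monoid G \<cong> sym_group 5"
proof -
  have d: "d = r"
    by (simp add: d_def s)
  \<comment> \<open>As \<open>d = r\<close> and \<open>s = 2 * r\<close>, the block has one point on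
    each short strand and two on each long one.\<close>
  interpret six_points "pt 0 0" "pt 1 0" "pt 2 0" "pt 3 0" "pt 2 d" "pt 3 d"
    by unfold_locales (use r_pos in \<open>simp add: pt_eq_iff len_def d s\<close>)
  have "B \<subseteq> points"
  proof
    fix b assume "b \<in> B"
    then obtain k q where kq: "k < 4" "b = pt k (d * q)" by (auto simp: B_def)
    have "k < 2 \<Longrightarrow> b = pt k 0"
      using kq by (simp add: pt_eq_iff len_def d)
    moreover have "2 \<le> k \<Longrightarrow> b = pt k (d * (q mod 2))"
      using kq by (simp add: pt_eq_iff len_def d s mult.commute[of 2] mult_mod_right[symmetric])
    moreover have "q mod 2 = 0 \<or> q mod 2 = 1" by auto
    moreover have "k = 0 \<or> k = 1 \<or> k = 2 \<or> k = 3" using kq by linarith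
    ultimately show "b \<in> points" by auto
  qed
  moreover have "points \<subseteq> B" by (simp add: pt_mem_B_iff)
  ultimately have B: "B = points" by blast
  \<comment> \<open>The long indices \<open>0\<close> and \<open>d\<close> give exactly the two
    4-cycles that generate \<open>stab\<close>.\<close>
  have stab_G: "stab \<subseteq> G"
    using four_cycle_mem_G[of 0 0] four_cycle_mem_G[of 0 d] by (intro stab_subset perm_subgroup_G) simp_all
  have wrap: "pt 0 d = pt 0 0" "pt 1 d = pt 1 0" "pt 2 (d + d) = pt 2 0" "pt 3 (d + d) = pt 3 0"
    by (simp_all add: pt_eq_iff len_def d s mult_2[symmetric])
  have "\<rho> \<in> stab"
  proof (rule stab_swap)
    show "\<rho> permutes points"
      using \<rho>_permutes B by simp
  qed (use wrap in \<open>simp_all add: \<rho>_pt\<close>)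
  then have K: "perm_subgroup stab" "stab \<subseteq> G" "\<rho> \<in> stab" "s1 \<in> stab"
    using perm_subgroup_stab stab_G stab_cycle1 by (simp_all add: s1_eq)
  have iso: "inv_into stab act \<in> iso (sym_group 5) (perm_monoid stab)"
    using group.iso_set_sym[OF group_perm_monoid[OF perm_subgroup_stab] act_iso] by simp
  \<comment> \<open>Here \<open>n = 6 * d\<close>: the block has six points, while the group acts on
    the five factors.\<close>
  have "n div d - 1 = 5"
    using r_pos by (simp add: n s d)
  then show "iso_some_semidirect_product (perm_monoid G) (group_power (sym_group (n div d - 1)) d)
      (integer_mod_group d)"
    using K iso stab_permutes B
    by (intro iso_some_semidirect_G[of stab]) (simp_all add: sym_group_is_group)
  show "perm_monoid G \<cong> sym_group 5" if "d = 1"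
    using G_eq_if_coprime[OF K that] act_iso is_isoI by metis
qed

end


section \<open>The tree\<close>

text \<open>\<open>funpow_dist1\<close> is the first return time; the iterates before it list the
  orbit without repetition, so it equals the cardinality.\<close>

lemma cyclic_on_funpow:
  assumes cyc: "cyclic_on f S" and x: "x \<in> S"
  shows "S = {(f ^^ i) x | i. True}"
    and "(f ^^ i) x = (f ^^ j) x \<longleftrightarrow> i mod card S = j mod card S"
proof -
  have S: "S = orbit f x"
    using cyc x by (auto simp: cyclic_on_alldef)
  with x have self: "x \<in> orbit f x" by simp
  show "S = {(f ^^ i) x | i. True}"
    unfolding S by (rule orbit_altdef_self_in[OF self])
  let ?m = "funpow_dist1 f x x"
  have inj: "inj_on (\<lambda>i. (f ^^ i) x) {0..<?m}"
    by (rule inj_on_funpow_dist1[OF self])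
  have card: "card S = ?m"
    unfolding S by (subst orbit_conv_funpow_dist1[OF self]) (simp add: card_image[OF inj])
  have mod: "(f ^^ (k mod ?m)) x = (f ^^ k) x" for k
    by (rule funpow_mod_eq[OF funpow_dist1_prop[OF self]])
  have "(f ^^ (i mod ?m)) x = (f ^^ (j mod ?m)) x \<longleftrightarrow> i mod ?m = j mod ?m"
    using inj_onD[OF inj, of "i mod ?m" "j mod ?m"] by auto
  then show "(f ^^ i) x = (f ^^ j) x \<longleftrightarrow> i mod card S = j mod card S"
    by (simp only: mod card)
qed

lemma Suc_mod_eqD:
  fixes i j m :: nat
  assumes "Suc i mod m = Suc j mod m"
  shows "i mod m = j mod m"
proof (cases m)
  case (Suc m')
  have "(Suc i + m') mod m = (Suc j + m') mod m"
    using assms by (metis mod_add_left_eq)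
  then show ?thesis by (simp add: Suc mod_Suc_eq flip: add_Suc_right)
qed (use assms in simp)

lemma tree_four_strands:
  fixes T :: "'v plane_graph"
  assumes rs: "0 < r" "r < s" and n: "n = 2 * r + 2 * s"
    and tree: "bicolored_plane_tree T"
    and pass: "passport T = ({#r, r, s, s#}, add_mset 4 (replicate_mset (n - 4) 1), n)"
    and w: "w \<in> white T" "vertex_degree T w = 4" "e \<in> incident T w"
    and around: "black_degrees_around T w e = [r, r, s, s]"
    and lab: "edge_labelling T lab"
  obtains pt where "four_strands r s n (sigma_black T lab) (sigma_white T lab) pt
    (\<lambda>k. if k < 2 then r else s) (gcd r s)"
proof -
  have finite: "finite (black T)" "finite (white T)" and disj: "black T \<inter> white T = {}"
    and edges: "edges T \<subseteq> black T \<times> white T"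
    and cyc: "\<And>v. v \<in> black T \<union> white T \<Longrightarrow> cyclic_on (rot T v) (incident T v)"
    using tree by (auto simp: bicolored_plane_tree_def)
  have degs: "image_mset (vertex_degree T) (mset_set (black T)) = {#r, r, s, s#}"
    "image_mset (vertex_degree T) (mset_set (white T)) = add_mset 4 (replicate_mset (n - 4) 1)"
    and card_edges: "card (edges T) = n"
    using pass by (auto simp: passport_def)
  have card_black: "card (black T) = 4"
    using arg_cong[OF degs(1), of size] by simp
  \<comment> \<open>Once \<open>w\<close> accounts for the entry \<open>4\<close> of the passport,
    only entries \<open>1\<close> remain.\<close>
  have deg_white: "vertex_degree T v = 1" if "v \<in> white T" "v \<noteq> w" for v
  proof -
    have "mset_set (white T) = add_mset w (mset_set (white T - {w}))"
      using finite(2) w(1) by (rule mset_set.remove)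
    then have "image_mset (vertex_degree T) (mset_set (white T - {w})) = replicate_mset (n - 4) 1"
      using degs(2) w(2) by simp
    moreover have "vertex_degree T v \<in># image_mset (vertex_degree T) (mset_set (white T - {w}))"
      using that finite(2) by simp
    ultimately show ?thesis
      by (metis in_replicate_mset)
  qed
  have incident_black: "incident T v = {a \<in> edges T. fst a = v}" if "v \<in> black T" for v
    using that edges disj by (auto simp: incident_def)
  have incident_white: "incident T v = {a \<in> edges T. snd a = v}" if "v \<in> white T" for v
    using that edges disj by (auto simp: incident_def)

  \<comment> \<open>The edges around the degree-4 white vertex\<close>
  define x where "x k = (rot T w ^^ k) e" for k
  have cyc_w: "cyclic_on (rot T w) (incident T w)" and card_w: "card (incident T w) = 4"
    using cyc[of w] w by (auto simp: vertex_degree_def)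
  note w_orbit = cyclic_on_funpow[OF cyc_w w(3), unfolded card_w, folded x_def]
  have x_mem: "x k \<in> edges T" and snd_x: "snd (x k) = w" for k
    using w_orbit(1) incident_white[OF w(1)] by auto
  have x_Suc: "rot T w (x k) = x (Suc k)" for k
    by (simp add: x_def)
  have w_edges: "\<exists>k<4. a = x k" if "a \<in> edges T" "snd a = w" for a
  proof -
    have "a \<in> incident T w"
      using that incident_white[OF w(1)] by simp
    then obtain k where "a = x k"
      using w_orbit(1) by auto
    then have "a = x (k mod 4)"
      by (simp add: w_orbit(2))
    then show ?thesis
      by (metis mod_less_divisor zero_less_numeral)
  qed

  \<comment> \<open>Its black neighbours\<close>
  define v where "v k = fst (x k)" for k
  have v_black: "v k \<in> black T" for k
    using x_mem[of k] edges by (auto simp: v_def)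
  have v_inj: "k = l" if "k < 4" "l < 4" "v k = v l" for k l
  proof -
    have "x k = x l"
      using that snd_x by (simp add: v_def prod_eq_iff)
    with that show ?thesis
      by (simp add: w_orbit(2))
  qed
  then have "inj_on v {..<4}"
    by (simp add: inj_on_def)
  \<comment> \<open>The four neighbours of \<open>w\<close> are distinct, and there are only four
    black vertices.\<close>
  then have black_eq: "black T = v ` {..<4}"
    using v_black finite(1) card_black by (intro card_subset_eq[symmetric]) (auto simp: card_image)
  let ?len = "\<lambda>k. if k < 2 then r else s"
  have deg_v: "vertex_degree T (v k) = ?len k" if "k < 4" for k
  proof -
    have eq: "map (\<lambda>k. vertex_degree T (v k)) [0..<4] = [r, r, s, s]"
      using around w(2) by (simp add: black_degrees_around_def v_def x_def)
    have "k = 0 \<or> k = 1 \<or> k = 2 \<or> k = 3"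
      using that by linarith
    then show ?thesis
      using eq by (auto simp: upt_rec numeral_2_eq_2 numeral_3_eq_3)
  qed

  \<comment> \<open>Edges numbered around each black vertex\<close>
  define E where "E k i = (rot T (v k) ^^ i) (x k)" for k i
  have x_inc: "x k \<in> incident T (v k)" for k
    using x_mem v_black by (simp add: incident_black v_def)
  have v_orbit: "incident T (v k) = {E k i | i. True}"
    "k < 4 \<Longrightarrow> E k i = E k j \<longleftrightarrow> i mod ?len k = j mod ?len k" for k i j
    using cyclic_on_funpow[OF cyc x_inc, of k] v_black[of k] deg_v[of k]
    unfolding E_def vertex_degree_def by auto
  have E_mem: "E k i \<in> edges T" and fst_E: "fst (E k i) = v k" for k i
    using v_orbit(1)[of k] incident_black[OF v_black[of k]] by auto
  have E_Suc: "rot T (v k) (E k i) = E k (Suc i)" for k i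
    by (simp add: E_def)
  have E_eq_iff: "E k i = E l j \<longleftrightarrow> k = l \<and> i mod ?len k = j mod ?len k"
    if "k < 4" "l < 4" for k l i j
    using that v_inj[of k l] v_orbit(2)[of k i j] fst_E[of k i] fst_E[of l j] by metis
  have edges_eq: "edges T = {E k i | k i. k < 4}"
  proof (intro subset_antisym subsetI)
    fix a assume a: "a \<in> edges T"
    then have "fst a \<in> black T"
      using edges by auto
    then obtain k where k: "k < 4" "fst a = v k"
      using black_eq by auto
    then have "a \<in> incident T (v k)"
      using a v_black incident_black by simp
    then show "a \<in> {E k i | k i. k < 4}"
      using k v_orbit(1) by auto
  qed (use E_mem in auto)

  \<comment> \<open>Transport to edge labels\<close>
  define \<iota> where "\<iota> = inv_into {1..n} lab"
  have lab_bij: "bij_betw lab {1..n} (edges T)"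
    using lab by (simp add: edge_labelling_def card_edges)
  then have \<iota>_bij: "bij_betw \<iota> (edges T) {1..n}"
    unfolding \<iota>_def by (rule bij_betw_inv_into)
  have lab_\<iota>: "lab (\<iota> a) = a" if "a \<in> edges T" for a
    using lab_bij that unfolding \<iota>_def by (rule bij_betw_inv_into_right)
  have \<iota>_mem: "\<iota> a \<in> {1..n}" if "a \<in> edges T" for a
    using \<iota>_bij that by (auto simp: bij_betw_def)
  have \<iota>_inj: "\<iota> a = \<iota> b \<longleftrightarrow> a = b" if "a \<in> edges T" "b \<in> edges T" for a b
    using lab_\<iota> that by metis
  have \<iota>_surj: "\<exists>a\<in>edges T. z = \<iota> a" if "z \<in> {1..n}" for z
    using \<iota>_bij that by (auto simp: bij_betw_def)
  have s0: "sigma_black T lab (\<iota> a) = \<iota> (rot T (fst a) a)"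
    and s1: "sigma_white T lab (\<iota> a) = \<iota> (rot T (snd a) a)" if "a \<in> edges T" for a
    using \<iota>_mem[OF that] lab_\<iota>[OF that]
    by (simp_all add: sigma_black_def sigma_white_def card_edges \<iota>_def)
  have s0_out: "sigma_black T lab z = z" and s1_out: "sigma_white T lab z = z" if "z \<notin> {1..n}" for z
    using that by (simp_all only: sigma_black_def sigma_white_def card_edges if_False)

  define pt where "pt k i = \<iota> (E k i)" for k i
  have pt_eq_iff: "pt k i = pt l j \<longleftrightarrow> k = l \<and> i mod ?len k = j mod ?len k"
    if "k < 4" "l < 4" for k l i j
    using E_eq_iff[OF that] by (simp add: pt_def \<iota>_inj E_mem)
  have s0_pt: "sigma_black T lab (pt k i) = pt k (Suc i)" for k i
    by (simp add: pt_def s0 E_mem fst_E E_Suc)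
  have points_eq: "{1..n} = {pt k i | k i. k < 4}"
  proof -
    have "{1..n} = \<iota> ` edges T"
      using \<iota>_bij by (simp add: bij_betw_def)
    also have "\<dots> = {pt k i | k i. k < 4}"
      unfolding edges_eq pt_def by blast
    finally show ?thesis .
  qed
  have s0_permutes: "sigma_black T lab permutes {1..n}"
  proof (rule bij_imp_permutes)
    have "inj_on (sigma_black T lab) {1..n}"
    proof (rule inj_onI)
      fix y z assume "y \<in> {1..n}" "z \<in> {1..n}" and eq: "sigma_black T lab y = sigma_black T lab z"
      then obtain k i l j where yz: "k < 4" "y = pt k i" "l < 4" "z = pt l j"
        unfolding points_eq by auto
      then have "pt k (Suc i) = pt l (Suc j)"
        using eq s0_pt by simp
      then have kl: "k = l" "Suc i mod ?len k = Suc j mod ?len k"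
        using pt_eq_iff[OF yz(1,3)] by blast+
      from kl(2) have "i mod ?len k = j mod ?len k"
        by (rule Suc_mod_eqD)
      then show "y = z"
        using pt_eq_iff[OF yz(1,3)] kl(1) yz by blast
    qed
    moreover have "sigma_black T lab ` {1..n} \<subseteq> {1..n}"
      unfolding points_eq using s0_pt by blast
    ultimately show "bij_betw (sigma_black T lab) {1..n} {1..n}"
      by (simp add: bij_betw_def endo_inj_surj)
  qed (rule s0_out)
  have E_0: "E k 0 = x k" for k
    by (simp add: E_def)
  have dist: "distinct [pt 0 0, pt 1 0, pt 2 0, pt 3 0]"
    by (simp add: pt_eq_iff)
  have s1_eq: "sigma_white T lab = four_cycle (pt 0 0) (pt 1 0) (pt 2 0) (pt 3 0)"
  proof
    fix z
    show "sigma_white T lab z = four_cycle (pt 0 0) (pt 1 0) (pt 2 0) (pt 3 0) z"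
    proof (cases "z \<in> {pt 0 0, pt 1 0, pt 2 0, pt 3 0}")
      case True
      have "x 4 = x 0"
        by (simp add: w_orbit(2))
      moreover have "sigma_white T lab (pt k 0) = \<iota> (x (Suc k))" for k
        by (simp add: pt_def E_0 s1 x_mem snd_x x_Suc)
      ultimately have "sigma_white T lab (pt 0 0) = pt 1 0" "sigma_white T lab (pt 1 0) = pt 2 0"
        "sigma_white T lab (pt 2 0) = pt 3 0" "sigma_white T lab (pt 3 0) = pt 0 0"
        by (simp_all add: pt_def E_0 numeral_eq_Suc)
      with True show ?thesis
        using four_cycle_apply(1-4)[OF dist] by (elim insertE) simp_all
    next
      case False
      then have fixed: "four_cycle (pt 0 0) (pt 1 0) (pt 2 0) (pt 3 0) z = z"
        by (intro four_cycle_apply(5)[OF dist]) auto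
      have "sigma_white T lab z = z"
      proof (cases "z \<in> {1..n}")
        case True
        then obtain a where a: "a \<in> edges T" "z = \<iota> a"
          using \<iota>_surj by blast
        \<comment> \<open>An edge away from \<open>w\<close> ends in a white vertex of degree one,
          whose rotation can only fix it.\<close>
        have "snd a \<noteq> w"
        proof
          assume "snd a = w"
          then obtain k where k: "k < 4" "z = pt k 0"
            using w_edges[OF a(1)] a(2) by (auto simp: pt_def E_0)
          then have "k = 0 \<or> k = 1 \<or> k = 2 \<or> k = 3"
            by linarith
          with k(2) False show False by auto
        qed
        moreover have u: "snd a \<in> white T"
          using a edges by auto
        ultimately have "card (incident T (snd a)) = 1"
          using deg_white by (simp add: vertex_degree_def)
        moreover have "a \<in> incident T (snd a)"
          using a u by (simp add: incident_white)
        ultimately have inc: "incident T (snd a) = {a}"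
          by (metis card_1_singletonE singletonD)
        then have "rot T (snd a) a \<in> {a}"
          using cyc[of "snd a"] u cyclic_on_f_in[of "rot T (snd a)" "{a}"]
          by (metis UnI2 cyclic_on_inI cyclic_on_alldef insertI1 orbit.base)
        then show ?thesis
          using a by (simp add: s1)
      qed (rule s1_out)
      with fixed show ?thesis by simp
    qed
  qed
  have "four_strands r s n (sigma_black T lab) (sigma_white T lab) pt ?len (gcd r s)"
  proof
    show "\<And>k i l j. k < 4 \<Longrightarrow> l < 4 \<Longrightarrow>
      pt k i = pt l j \<longleftrightarrow> k = l \<and> i mod ?len k = j mod ?len k"
      by (rule pt_eq_iff)
  qed (use rs n s0_permutes points_eq s0_pt s1_eq in simp_all)
  then show thesis
    by (rule that)
qed

theorem lemma4p4:
  fixes r s n d :: nat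
    and T :: "'v plane_graph"
    and w :: 'v and e :: "'v \<times> 'v"
    and lab :: "nat \<Rightarrow> 'v \<times> 'v"
    and G :: "(nat \<Rightarrow> nat) monoid"
  assumes "0 < r" and "r < s"
    and "n = 2 * r + 2 * s"
    and "d = gcd r s"
    and "bicolored_plane_tree T"
    and "passport T = ({#r, r, s, s#}, add_mset 4 (replicate_mset (n - 4) 1), n)"
    and "w \<in> white T" and "vertex_degree T w = 4" and "e \<in> incident T w"
    and "black_degrees_around T w e = [r, r, s, s]"
    and "edge_labelling T lab"
    and "G = monodromy_group T lab"
  shows "(r = 1 \<and> s = 2 \<longrightarrow> G \<cong> sym_group 5) \<and>
         (d = 1 \<and> s \<noteq> 2 \<longrightarrow> G \<cong> sym_group n) \<and>
         (d \<noteq> 1 \<and> s \<noteq> 2 * r \<longrightarrow>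
            iso_some_semidirect_product G
              (group_power (sym_group (n div d)) d) (integer_mod_group d)) \<and>
         (d \<noteq> 1 \<and> s = 2 * r \<longrightarrow>
            iso_some_semidirect_product G
              (group_power (sym_group (n div d - 1)) d) (integer_mod_group d))"
proof -
  obtain pt where "four_strands r s n (sigma_black T lab) (sigma_white T lab) pt
      (\<lambda>k. if k < 2 then r else s) (gcd r s)"
    using tree_four_strands[OF assms(1-3,5-11)] .
  then interpret M: four_strands r s n "sigma_black T lab" "sigma_white T lab" pt
      "\<lambda>k. if k < 2 then r else s" d
    unfolding assms(4) .
  have card: "card (edges T) = n"
    using assms(6) by (simp add: passport_def)
  have G: "G = perm_monoid M.G"
    using M.gens_subset
    by (simp add: assms(12) monodromy_group_def subgroup_generated_def card M.G_def
        sym_group_def perm_monoid_def Int_absorb1)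
  \<comment> \<open>If \<open>s = 2 * r\<close> then \<open>d = r\<close>, so \<open>d = 1\<close>
    would give \<open>s = 2\<close>; hence the second case is generic.\<close>
  have "s \<noteq> 2 * r" if "d = 1" "s \<noteq> 2"
    using that M.d_def by auto
  then show ?thesis
    using M.generic_case M.exceptional_case assms(4) unfolding G
    by (auto simp: iso_refl)
qed

end
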